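(* Let $(\Phi,\bar y)$ be a relatively normalized ovaloid in $\mathbb{R}^3$, with positive definite second fundamental form $II$, support function $q$ and mean relative curvature $H$. Then $$\iint_M\left(\frac{H}{q}-\frac{H_{\mathrm{aff}}}{q_{\mathrm{aff}}}\right)dO_{II}\ge 0,$$ where $dO_{II}$ is the element of area of $\Phi$ with respect to the second fundamental form $II$ of $\Phi$, and $H_{\mathrm{aff}}$, $q_{\mathrm{aff}}$ are the mean relative curvature and the support function of the equiaffine normalization $\bar y_{\mathrm{aff}}$ of $\Phi$. The equality is valid if and only if $\bar y$ is constantly proportional to $\bar y_{\mathrm{aff}}$.
   Context: An ovaloid $\Phi=(M,\bar x)$ in $\mathbb{R}^3$ is a closed surface of positive Gaussian curvature: $M$ is an oriented connected compact $2$-dimensional $C^r$-manifold without boundary ($r\ge3$) and $\bar x:M\to\mathbb{R}^3$ is a $C^r$-immersion with Gaussian curvature $K_I>0$. Let $u^1,u^2$ be local coordinates and write $f_{/i}=\partial f/\partial u^i$, etc. Let $\bar\xi$ be the Euclidean unit normal field, $h_{ij}=\langle\bar\xi,\bar x_{/ij}\rangle$ the components of the second fundamental form $II$; $\bar\xi$ is chosen so that $II$ is positive definite. A $C^s$-map $\bar y:M\to\mathbb{R}^{3}$ ($r>s\ge1$) is a relative normalization of $\Phi$ if at every point of $M$ the vectors $\bar x_{/1},\bar x_{/2},\bar y$ are linearly independent and every $\bar y_{/i}$ lies in the span of $\bar x_{/1},\bar x_{/2}$; then $(\Phi,\bar y)$ is called relatively normalized. Here $r,s$ are understood to be large enough for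 all quantities involved to be defined. The support function of $\bar y$ is $q=\langle\bar\xi,\bar y\rangle$; it never vanishes, and orientations are chosen so that $q>0$. The relative shape operator $B_i^j$ is defined by $\bar y_{/i}=-B_i^j\bar x_{/j}$, and the mean relative curvature is $H=\frac12\operatorname{tr}(B_i^j)$. The equiaffine normalization $\bar y_{\mathrm{aff}}$ is the (unique) relative normalization with support function $q_{\mathrm{aff}}=|K_I|^{1/4}$; the subscript "aff" denotes quantities formed for $\bar y_{\mathrm{aff}}$. The normalizations $\bar y$ and $\bar y_{\mathrm{aff}}$ are called constantly proportional if $q=c\,q_{\mathrm{aff}}$ for a constant $c\in\mathbb{R}\setminus\{0\}$ (equivalently $\bar y=c\,\bar y_{\mathrm{aff}}$). *)

theory Defs
  imports "HOL-Analysis.Analysis"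
begin

section \<open>Maps of class $C^k$ on open subsets of Euclidean space\<close>

definition partial :: "'n::finite \<Rightarrow> (real^'n \<Rightarrow> 'b::real_normed_vector) \<Rightarrow> real^'n \<Rightarrow> 'b" where
  "partial i f u = frechet_derivative f (at u) (axis i 1)"

text \<open>Only meant for open \<open>S\<close>; \<open>frechet_derivative\<close> carries information only where
  \<open>f\<close> is differentiable, hence the explicit differentiability clause.\<close>

primrec Ck_on :: "nat \<Rightarrow> (real^'n::finite \<Rightarrow> 'b::real_normed_vector) \<Rightarrow> (real^'n) set \<Rightarrow> bool" where
  "Ck_on 0 f S \<longleftrightarrow> continuous_on S f"
| "Ck_on (Suc k) f S \<longleftrightarrow> (\<forall>u\<in>S. f differentiable (at u)) \<and> (\<forall>i. Ck_on k (partial i f) S)"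

section \<open>Closed oriented surfaces\<close>

text \<open>A chart is a pair \<open>(U, \<phi>)\<close> of its domain in the surface and its coordinate map.\<close>

type_synonym 'a chart = "'a set \<times> ('a \<Rightarrow> real^2)"

definition chart_on :: "'a::topological_space set \<Rightarrow> 'a chart \<Rightarrow> bool" where
  "chart_on M c \<longleftrightarrow>
     openin (top_of_set M) (fst c) \<and> open (snd c ` fst c) \<and>
     (\<exists>\<psi>. homeomorphism (fst c) (snd c ` fst c) (snd c) \<psi>)"

definition local_rep :: "'a chart \<Rightarrow> ('a \<Rightarrow> 'b) \<Rightarrow> real^2 \<Rightarrow> 'b" where
  "local_rep c f = f \<circ> inv_into (fst c) (snd c)"

definition Ck_atlas :: "nat \<Rightarrow> 'a::topological_space set \<Rightarrow> 'a chart set \<Rightarrow> bool" where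
  "Ck_atlas r M A \<longleftrightarrow>
     (\<forall>c\<in>A. chart_on M c) \<and> (\<Union>c\<in>A. fst c) = M \<and>
     (\<forall>c\<in>A. \<forall>d\<in>A. Ck_on r (local_rep c (snd d)) (snd c ` (fst c \<inter> fst d)))"

definition oriented_atlas :: "'a chart set \<Rightarrow> bool" where
  "oriented_atlas A \<longleftrightarrow>
     (\<forall>c\<in>A. \<forall>d\<in>A. \<forall>u\<in>snd c ` (fst c \<inter> fst d).
        det (matrix (frechet_derivative (local_rep c (snd d)) (at u))) > 0)"

text \<open>The Hausdorff property comes from the type class; second countability follows from
  compactness.\<close>

definition closed_oriented_surface :: "nat \<Rightarrow> 'a::t2_space set \<Rightarrow> 'a chart set \<Rightarrow> bool" where
  "closed_oriented_surface r M A \<longleftrightarrow>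
     Ck_atlas r M A \<and> oriented_atlas A \<and> compact M \<and> connected M \<and> M \<noteq> {}"

definition Ck_map :: "nat \<Rightarrow> 'a chart set \<Rightarrow> ('a \<Rightarrow> real^3) \<Rightarrow> bool" where
  "Ck_map k A f \<longleftrightarrow> (\<forall>c\<in>A. Ck_on k (local_rep c f) (snd c ` fst c))"

text \<open>Used to turn expressions in local coordinates that do not depend on the choice of
  coordinates into functions on the surface.\<close>

definition chart_at :: "'a chart set \<Rightarrow> 'a \<Rightarrow> 'a chart" where
  "chart_at A p = (SOME c. c \<in> A \<and> p \<in> fst c)"

section \<open>Euclidean geometry of an immersed surface\<close>

definition immersion :: "'a chart set \<Rightarrow> ('a \<Rightarrow> real^3) \<Rightarrow> bool" where
  "immersion A x \<longleftrightarrow>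
     (\<forall>c\<in>A. \<forall>u\<in>snd c ` fst c. inj (frechet_derivative (local_rep c x) (at u)))"

definition unit_normal_field ::
    "'a::topological_space set \<Rightarrow> 'a chart set \<Rightarrow> ('a \<Rightarrow> real^3) \<Rightarrow> ('a \<Rightarrow> real^3) \<Rightarrow> bool" where
  "unit_normal_field M A x \<xi> \<longleftrightarrow>
     continuous_on M \<xi> \<and> (\<forall>p\<in>M. norm (\<xi> p) = 1) \<and>
     (\<forall>c\<in>A. \<forall>u\<in>snd c ` fst c. \<forall>i. local_rep c \<xi> u \<bullet> partial i (local_rep c x) u = 0)"

definition first_form :: "'a chart \<Rightarrow> ('a \<Rightarrow> real^3) \<Rightarrow> real^2 \<Rightarrow> real^2^2" where
  "first_form c x u = (\<chi> i j. partial i (local_rep c x) u \<bullet> partial j (local_rep c x) u)"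

definition second_form ::
    "'a chart \<Rightarrow> ('a \<Rightarrow> real^3) \<Rightarrow> ('a \<Rightarrow> real^3) \<Rightarrow> real^2 \<Rightarrow> real^2^2" where
  "second_form c x \<xi> u =
     (\<chi> i j. local_rep c \<xi> u \<bullet> partial j (partial i (local_rep c x)) u)"

definition gauss_curvature ::
    "'a chart set \<Rightarrow> ('a \<Rightarrow> real^3) \<Rightarrow> ('a \<Rightarrow> real^3) \<Rightarrow> 'a \<Rightarrow> real" where
  "gauss_curvature A x \<xi> p =
     (let c = chart_at A p; u = snd c p
      in det (second_form c x \<xi> u) / det (first_form c x u))"

definition positive_definite_II ::
    "'a chart set \<Rightarrow> ('a \<Rightarrow> real^3) \<Rightarrow> ('a \<Rightarrow> real^3) \<Rightarrow> bool" where
  "positive_definite_II A x \<xi> \<longleftrightarrow>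
     (\<forall>c\<in>A. \<forall>u\<in>snd c ` fst c. \<forall>v. v \<noteq> 0 \<longrightarrow> v \<bullet> (second_form c x \<xi> u *v v) > 0)"

text \<open>For \<open>K > 0\<close> exactly one of the two unit normal fields of the connected surface makes
  the second fundamental form positive definite; \<open>\<xi>\<close> is that one.\<close>

definition ovaloid ::
    "nat \<Rightarrow> 'a::t2_space set \<Rightarrow> 'a chart set \<Rightarrow> ('a \<Rightarrow> real^3) \<Rightarrow> ('a \<Rightarrow> real^3) \<Rightarrow> bool" where
  "ovaloid r M A x \<xi> \<longleftrightarrow>
     closed_oriented_surface r M A \<and> Ck_map r A x \<and> immersion A x \<and>
     unit_normal_field M A x \<xi> \<and> (\<forall>p\<in>M. gauss_curvature A x \<xi> p > 0) \<and>
     positive_definite_II A x \<xi>"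

text \<open>The Borel measure on \<open>M\<close> with density \<open>sqrt (det h)\<close> with respect to
  \<open>du\<^sup>1 du\<^sup>2\<close> in every chart.\<close>

definition area_II ::
    "'a::topological_space set \<Rightarrow> 'a chart set \<Rightarrow> ('a \<Rightarrow> real^3) \<Rightarrow> ('a \<Rightarrow> real^3) \<Rightarrow> 'a measure" where
  "area_II M A x \<xi> =
     (THE \<mu>. sets \<mu> = sets (restrict_space borel M) \<and>
        (\<forall>c\<in>A. \<forall>B\<in>sets \<mu>. B \<subseteq> fst c \<longrightarrow>
           emeasure \<mu> B =
             (\<integral>\<^sup>+ u \<in> snd c ` B. ennreal (sqrt (det (second_form c x \<xi> u))) \<partial>lborel)))"

section \<open>Relative normalizations\<close>

definition relative_normalization ::
    "nat \<Rightarrow> 'a chart set \<Rightarrow> ('a \<Rightarrow> real^3) \<Rightarrow> ('a \<Rightarrow> real^3) \<Rightarrow> bool" where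
  "relative_normalization s A x y \<longleftrightarrow>
     Ck_map s A y \<and>
     (\<forall>c\<in>A. \<forall>u\<in>snd c ` fst c.
        (\<forall>\<alpha> \<beta> \<gamma>. \<alpha> *\<^sub>R partial 1 (local_rep c x) u + \<beta> *\<^sub>R partial 2 (local_rep c x) u
                   + \<gamma> *\<^sub>R local_rep c y u = 0 \<longrightarrow> \<alpha> = 0 \<and> \<beta> = 0 \<and> \<gamma> = 0) \<and>
        (\<forall>i. partial i (local_rep c y) u
               \<in> span {partial 1 (local_rep c x) u, partial 2 (local_rep c x) u}))"

definition support_fun :: "('a \<Rightarrow> real^3) \<Rightarrow> ('a \<Rightarrow> real^3) \<Rightarrow> 'a \<Rightarrow> real" where
  "support_fun \<xi> y p = \<xi> p \<bullet> y p"

text \<open>Row \<open>i\<close>, column \<open>j\<close> holds the component with lower index \<open>i\<close> and upper index \<open>j\<close>.\<close>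

definition relative_shape ::
    "'a chart \<Rightarrow> ('a \<Rightarrow> real^3) \<Rightarrow> ('a \<Rightarrow> real^3) \<Rightarrow> real^2 \<Rightarrow> real^2^2" where
  "relative_shape c x y u =
     (THE B. \<forall>i. partial i (local_rep c y) u =
                 - (\<Sum>j\<in>UNIV. (B $ i $ j) *\<^sub>R partial j (local_rep c x) u))"

definition mean_relative_curvature ::
    "'a chart set \<Rightarrow> ('a \<Rightarrow> real^3) \<Rightarrow> ('a \<Rightarrow> real^3) \<Rightarrow> 'a \<Rightarrow> real" where
  "mean_relative_curvature A x y p =
     (let c = chart_at A p in trace (relative_shape c x y (snd c p)) / 2)"

definition equiaffine_normalization ::
    "nat \<Rightarrow> 'a set \<Rightarrow> 'a chart set \<Rightarrow> ('a \<Rightarrow> real^3) \<Rightarrow> ('a \<Rightarrow> real^3) \<Rightarrow> ('a \<Rightarrow> real^3) \<Rightarrow> bool" where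
  "equiaffine_normalization s M A x \<xi> y \<longleftrightarrow>
     relative_normalization s A x y \<and>
     (\<forall>p\<in>M. support_fun \<xi> y p = \<bar>gauss_curvature A x \<xi> p\<bar> powr (1/4))"

definition constantly_proportional ::
    "'a set \<Rightarrow> ('a \<Rightarrow> real^3) \<Rightarrow> ('a \<Rightarrow> real^3) \<Rightarrow> ('a \<Rightarrow> real^3) \<Rightarrow> bool" where
  "constantly_proportional M \<xi> y y' \<longleftrightarrow>
     (\<exists>c. c \<noteq> 0 \<and> (\<forall>p\<in>M. support_fun \<xi> y p = c * support_fun \<xi> y' p))"

end

(*
  Along a chart, write w for the quotient of the two support functions q and q_aff. The field
  Z = y - w y_aff is tangent to the surface, and the 1-form det(y, y_aff, dx) has exterior
  derivative 2 q q_aff (H/q - H_aff/q_aff) det(x_1, x_2, xi) du^1 du^2, because the derivatives of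
  y and y_aff are tangent. Since q_aff^4 = K_I, the density sqrt(det h) of dO_II equals
  q_aff^2 |det(x_1, x_2, xi)|. Hence Stokes' theorem for 1/w times the 1-form reads

    2 * integral of (H/q - H_aff/q_aff) dO_II = integral of II(Z, Z) / (w q_aff)^2 dO_II,

  because differentiating <xi, Z> = 0 gives q_aff dw = - II(Z, .). The right-hand side is
  nonnegative, and it vanishes only if Z = 0, which forces dw = 0, so that w is constant.
*)
theory Submission
  imports Defs
begin

subsection \<open>Calculus in Euclidean space\<close>

text \<open>The weight 1/w is forced: the exterior derivative carries the factor q q_aff, the
  density carries q_aff^2, and their quotient is w. The same weight contributes the term -dw(Z)/w^2,
  which has a sign. Stokes' theorem is reduced to the fact that a partial derivative of a compactly
  supported C^1 function on the plane has integral zero. A partition of unity cuts the form into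
  pieces supported in single charts; only first derivatives of the cut-off functions enter, so class
  C^1 is enough for them. In the exterior derivative only x is differentiated twice, and its mixed
  derivatives cancel by symmetry. Two further points shape the proof. The normal \<xi> is fixed by
  the sign of II, so det(x_1, x_2, \<xi>) can be negative in a chart; its sign is carried along as a
  locally constant factor. And the area measure is given by a definite description, so a measure
  with the required density in every chart has to be constructed and shown to be unique before
  anything can be integrated.\<close>

lemma partial_eq:
  assumes "(f has_derivative f') (at u)"
  shows "partial i f u = f' (axis i 1)"
  using frechet_derivative_at[OF assms] by (simp add: partial_def)

lemma has_derivative_partial:
  fixes f :: "real^'n::finite \<Rightarrow> 'b::real_normed_vector"
  assumes "f differentiable (at u)"
  shows "(f has_derivative (\<lambda>v. \<Sum>i\<in>UNIV. v $ i *\<^sub>R partial i f u)) (at u)"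
proof -
  let ?D = "frechet_derivative f (at u)"
  have D: "(f has_derivative ?D) (at u)"
    using assms by (simp add: frechet_derivative_works)
  then have lin: "linear ?D" by (rule has_derivative_linear)
  have "?D v = (\<Sum>i\<in>UNIV. v $ i *\<^sub>R partial i f u)" for v
  proof -
    have "?D v = ?D (\<Sum>i\<in>UNIV. v $ i *s axis i 1)"
      by (simp only: basis_expansion)
    also have "\<dots> = (\<Sum>i\<in>UNIV. v $ i *\<^sub>R ?D (axis i 1))"
      using lin by (simp add: linear_sum linear_cmul scalar_mult_eq_scaleR)
    finally show ?thesis by (simp add: partial_def)
  qed
  then have "?D = (\<lambda>v. \<Sum>i\<in>UNIV. v $ i *\<^sub>R partial i f u)" by blast
  with D show ?thesis by simp
qed

lemma Ck_on_SucD: "Ck_on (Suc k) f S \<Longrightarrow> Ck_on k f S"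
proof (induction k arbitrary: f)
  case 0
  then show ?case
    by (auto intro!: continuous_at_imp_continuous_on differentiable_imp_continuous_within)
next
  case (Suc k)
  then show ?case by (subst (asm) Ck_on.simps(2)) auto
qed

lemma Ck_on_mono: "Ck_on m f S \<Longrightarrow> k \<le> m \<Longrightarrow> Ck_on k f S"
  by (induction m) (auto simp: le_Suc_eq simp del: Ck_on.simps intro: Ck_on_SucD)

lemma Ck_on_subset: "Ck_on k f S \<Longrightarrow> T \<subseteq> S \<Longrightarrow> Ck_on k f T"
  by (induction k arbitrary: f) (auto intro: continuous_on_subset)

lemma Ck_on_1_iff:
  "Ck_on 1 f S \<longleftrightarrow> (\<forall>u\<in>S. f differentiable (at u)) \<and> (\<forall>i. continuous_on S (partial i f))"
  by (simp add: One_nat_def)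

lemma C1_I:
  assumes "\<And>u. u \<in> S \<Longrightarrow> (f has_derivative f' u) (at u)"
    and "\<And>i. continuous_on S (\<lambda>u. f' u (axis i 1))"
  shows "Ck_on 1 f S"
proof -
  have "continuous_on S (partial i f)" for i
    using assms(2)[of i] partial_eq[OF assms(1), of _ i]
    by (subst continuous_on_cong[OF refl, where g = "\<lambda>u. f' u (axis i 1)"]) auto
  then show ?thesis
    unfolding Ck_on_1_iff differentiable_def using assms(1) by blast
qed

lemma C1_differentiable: "Ck_on 1 f S \<Longrightarrow> u \<in> S \<Longrightarrow> f differentiable (at u)"
  by (simp add: Ck_on_1_iff)

lemma C1_continuous_partial: "Ck_on 1 f S \<Longrightarrow> continuous_on S (partial i f)"
  by (simp add: Ck_on_1_iff)

lemma C1_continuous: "Ck_on 1 f S \<Longrightarrow> continuous_on S f"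
  using Ck_on_mono[of 1 f S 0] by simp

lemma C1_has_derivative:
  fixes f :: "real^'n::finite \<Rightarrow> 'b::real_normed_vector"
  shows "Ck_on 1 f S \<Longrightarrow> u \<in> S \<Longrightarrow>
    (f has_derivative (\<lambda>v. \<Sum>i\<in>UNIV. v $ i *\<^sub>R partial i f u)) (at u)"
  by (intro has_derivative_partial C1_differentiable)

text \<open>Equality on the open set \<open>S\<close> is all that coordinate expressions offer: off
  the range of a chart \<open>inv_into\<close> returns unspecified points. Openness turns it into
  equality near each point of \<open>S\<close>, so the derivatives agree as well.\<close>

lemma C1_transform_open:
  assumes "Ck_on 1 f S" "open S" "\<And>u. u \<in> S \<Longrightarrow> f u = g u"
  shows "Ck_on 1 g S"
proof (rule C1_I)
  fix u assume u: "u \<in> S"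
  show "(g has_derivative (\<lambda>v. \<Sum>i\<in>UNIV. v $ i *\<^sub>R partial i f u)) (at u)"
    by (rule has_derivative_transform_within_open[OF C1_has_derivative[OF assms(1) u] assms(2) u])
      (use assms(3) in auto)
next
  fix i
  have "(\<Sum>j\<in>UNIV. (axis i 1 :: real^'a) $ j *\<^sub>R partial j f u) = partial i f u" for u
    by (simp add: axis_def if_distrib[of "\<lambda>c. c *\<^sub>R _"] cong: if_cong)
  then show "continuous_on S (\<lambda>u. \<Sum>j\<in>UNIV. (axis i 1 :: real^'a) $ j *\<^sub>R partial j f u)"
    using C1_continuous_partial[OF assms(1)] by simp
qed

lemma C1_Un_open:
  assumes "Ck_on 1 f S" "Ck_on 1 f T" "open S" "open T"
  shows "Ck_on 1 f (S \<union> T)"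
  using assms by (auto simp: Ck_on_1_iff intro: continuous_on_open_Un)

lemma C1_const [simp]: "Ck_on 1 (\<lambda>_. c) S"
  by (rule C1_I[where f' = "\<lambda>_ _. 0"]) auto

lemma partial_bilinear:
  fixes f :: "real^'n::finite \<Rightarrow> 'b::real_normed_vector" and g :: "real^'n \<Rightarrow> 'c::real_normed_vector"
  assumes "bounded_bilinear pr" "f differentiable (at u)" "g differentiable (at u)"
  shows "partial i (\<lambda>u. pr (f u) (g u)) u
    = pr (f u) (partial i g u) + pr (partial i f u) (g u)"
  by (rule trans[OF partial_eq[OF bounded_bilinear.FDERIV[OF assms(1)
        assms(2,3)[unfolded frechet_derivative_works]]]])
    (simp add: partial_def)

lemma C1_bilinear:
  fixes f :: "real^'n::finite \<Rightarrow> 'b::real_normed_vector" and g :: "real^'n \<Rightarrow> 'c::real_normed_vector"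
  assumes b: "bounded_bilinear pr" and f: "Ck_on 1 f S" and g: "Ck_on 1 g S"
  shows "Ck_on 1 (\<lambda>u. pr (f u) (g u)) S"
proof (rule C1_I)
  fix u assume u: "u \<in> S"
  show "((\<lambda>u. pr (f u) (g u)) has_derivative
      (\<lambda>v. pr (f u) (frechet_derivative g (at u) v) + pr (frechet_derivative f (at u) v) (g u))) (at u)"
    by (rule bounded_bilinear.FDERIV[OF b
        C1_differentiable[OF f u, unfolded frechet_derivative_works]
        C1_differentiable[OF g u, unfolded frechet_derivative_works]])
next
  fix i
  show "continuous_on S (\<lambda>u. pr (f u) (frechet_derivative g (at u) (axis i 1))
      + pr (frechet_derivative f (at u) (axis i 1)) (g u))"
    using C1_continuous_partial[OF f, of i] C1_continuous_partial[OF g, of i]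
      C1_continuous[OF f] C1_continuous[OF g]
    by (auto intro!: continuous_intros bounded_bilinear.continuous_on[OF b] simp: partial_def[abs_def])
qed

lemmas C1_mult = C1_bilinear[OF bounded_bilinear_mult]
lemmas C1_scaleR = C1_bilinear[OF bounded_bilinear_scaleR]
lemmas C1_inner = C1_bilinear[OF bounded_bilinear_inner]

lemma bounded_bilinear_cross3: "bounded_bilinear cross3"
  using bilinear_cross bilinear_conv_bounded_bilinear by blast

lemmas C1_cross = C1_bilinear[OF bounded_bilinear_cross3]
lemmas partial_mult = partial_bilinear[OF bounded_bilinear_mult]
lemmas partial_scaleR = partial_bilinear[OF bounded_bilinear_scaleR]
lemmas partial_inner = partial_bilinear[OF bounded_bilinear_inner]
lemmas partial_cross = partial_bilinear[OF bounded_bilinear_cross3]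

lemma partial_add:
  assumes "f differentiable (at u)" "g differentiable (at u)"
  shows "partial i (\<lambda>u. f u + g u) u = partial i f u + partial i g u"
  using partial_eq[OF has_derivative_add[OF assms[unfolded frechet_derivative_works]]]
  by (simp add: partial_def)

lemma partial_diff:
  assumes "f differentiable (at u)" "g differentiable (at u)"
  shows "partial i (\<lambda>u. f u - g u) u = partial i f u - partial i g u"
  using partial_eq[OF has_derivative_diff[OF assms[unfolded frechet_derivative_works]]]
  by (simp add: partial_def)

lemma C1_add:
  assumes "Ck_on 1 f S" "Ck_on 1 g S"
  shows "Ck_on 1 (\<lambda>u. f u + g u) S"
proof -
  have "continuous_on S (partial i (\<lambda>u. f u + g u))" for i
    using assms
    by (subst continuous_on_cong[OF refl partial_add])
      (auto simp: Ck_on_1_iff intro!: continuous_intros)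
  then show ?thesis using assms by (simp add: Ck_on_1_iff)
qed

declare Ck_on.simps(2) [simp del] One_nat_def [simp del]

lemma C1_sum: "finite I \<Longrightarrow> (\<And>i. i \<in> I \<Longrightarrow> Ck_on 1 (f i) S) \<Longrightarrow> Ck_on 1 (\<lambda>u. \<Sum>i\<in>I. f i u) S"
  by (induction I rule: finite_induct) (auto intro: C1_add)

lemma partial_real_compose:
  assumes "(\<phi> has_real_derivative d) (at (f u))" "f differentiable (at u)"
  shows "partial i (\<lambda>u. \<phi> (f u)) u = d * partial i f u"
proof -
  have "((\<lambda>u. \<phi> (f u)) has_derivative (\<lambda>v. d * frechet_derivative f (at u) v)) (at u)"
    using has_derivative_compose[OF assms(2)[unfolded frechet_derivative_works]
        assms(1)[unfolded has_field_derivative_def]] by simp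
  from partial_eq[OF this] show ?thesis by (simp add: partial_def)
qed

lemma C1_real_compose:
  fixes f :: "real^'n::finite \<Rightarrow> real"
  assumes f: "Ck_on 1 f S" and \<phi>: "\<And>u. u \<in> S \<Longrightarrow> (\<phi> has_real_derivative \<phi>' (f u)) (at (f u))"
    and c: "continuous_on (f ` S) \<phi>'"
  shows "Ck_on 1 (\<lambda>u. \<phi> (f u)) S"
proof (rule C1_I)
  fix u assume u: "u \<in> S"
  show "((\<lambda>u. \<phi> (f u)) has_derivative (\<lambda>v. \<phi>' (f u) * frechet_derivative f (at u) v)) (at u)"
    using has_derivative_compose[OF C1_differentiable[OF f u, unfolded frechet_derivative_works]
        \<phi>[OF u, unfolded has_field_derivative_def]] by simp
next
  fix i
  have "continuous_on S (\<lambda>u. \<phi>' (f u))"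
    using continuous_on_compose[OF C1_continuous[OF f] c] by (simp add: o_def)
  then show "continuous_on S (\<lambda>u. \<phi>' (f u) * frechet_derivative f (at u) (axis i 1))"
    using C1_continuous_partial[OF f, of i]
    by (auto intro!: continuous_intros simp: partial_def[abs_def])
qed

lemma C1_inverse:
  assumes "Ck_on 1 f S" "\<And>u. u \<in> S \<Longrightarrow> f u \<noteq> (0::real)"
  shows "Ck_on 1 (\<lambda>u. inverse (f u)) S"
  by (rule C1_real_compose[OF assms(1), where \<phi>' = "\<lambda>t. - inverse (t^2)"])
    (use assms(2) in \<open>auto intro!: DERIV_inverse[unfolded numeral_2_eq_2[symmetric], THEN DERIV_cong] continuous_intros
      simp: power_inverse\<close>)

lemma C1_divide:
  fixes f g :: "real^'n::finite \<Rightarrow> real"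
  assumes "Ck_on 1 f S" "Ck_on 1 g S" "\<And>u. u \<in> S \<Longrightarrow> g u \<noteq> 0"
  shows "Ck_on 1 (\<lambda>u. f u / g u) S"
  unfolding divide_inverse by (intro C1_mult C1_inverse assms)

lemma C1_norm:
  fixes f :: "real^'n::finite \<Rightarrow> 'b::real_inner"
  assumes "Ck_on 1 f S" "\<And>u. u \<in> S \<Longrightarrow> f u \<noteq> 0"
  shows "Ck_on 1 (\<lambda>u. norm (f u)) S"
  unfolding norm_eq_sqrt_inner
  by (rule C1_real_compose[OF C1_inner[OF assms(1,1)], where \<phi>' = "\<lambda>t. inverse (sqrt t) / 2"])
    (use assms(2) in \<open>auto intro!: DERIV_real_sqrt continuous_intros\<close>)

lemma partial_compose:
  fixes g :: "real^'n::finite \<Rightarrow> real^'m::finite" and f :: "real^'m \<Rightarrow> 'b::real_normed_vector"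
  assumes "f differentiable (at (g u))" "g differentiable (at u)"
  shows "partial i (\<lambda>u. f (g u)) u = (\<Sum>j\<in>UNIV. partial i g u $ j *\<^sub>R partial j f (g u))"
  by (rule trans[OF partial_eq[OF has_derivative_compose[OF assms(2)[unfolded frechet_derivative_works]
        has_derivative_partial[OF assms(1)]]]]) (simp add: partial_def)

lemma C1_compose:
  fixes g :: "real^'n::finite \<Rightarrow> real^'m::finite" and f :: "real^'m \<Rightarrow> 'b::real_normed_vector"
  assumes f: "Ck_on 1 f T" and g: "Ck_on 1 g S" and sub: "g ` S \<subseteq> T"
  shows "Ck_on 1 (\<lambda>u. f (g u)) S"
proof (rule C1_I)
  fix u assume u: "u \<in> S"
  then have "g u \<in> T" using sub by auto
  then show "((\<lambda>u. f (g u)) has_derivative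
      (\<lambda>v. \<Sum>j\<in>UNIV. frechet_derivative g (at u) v $ j *\<^sub>R partial j f (g u))) (at u)"
    by (intro has_derivative_compose[OF C1_differentiable[OF g u, unfolded frechet_derivative_works]
        C1_has_derivative[OF f]])
next
  fix i
  have "continuous_on S (\<lambda>u. partial j f (g u))" for j
    using continuous_on_compose2[OF C1_continuous_partial[OF f] C1_continuous[OF g] sub] .
  then show "continuous_on S (\<lambda>u. \<Sum>j\<in>UNIV. frechet_derivative g (at u) (axis i 1) $ j *\<^sub>R partial j f (g u))"
    using C1_continuous_partial[OF g, of i]
    by (auto intro!: continuous_intros simp: partial_def[abs_def])
qed

section \<open>Symmetry of second derivatives\<close>

lemma DERIV_along_line:
  fixes f :: "real^'n::finite \<Rightarrow> real"
  assumes "f differentiable (at (v + t *\<^sub>R axis i 1))"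
  shows "((\<lambda>t. f (v + t *\<^sub>R axis i 1)) has_real_derivative partial i f (v + t *\<^sub>R axis i 1)) (at t)"
proof -
  let ?D = "frechet_derivative f (at (v + t *\<^sub>R axis i 1))"
  have D: "(f has_derivative ?D) (at (v + t *\<^sub>R axis i 1))"
    using assms by (simp add: frechet_derivative_works)
  have "((\<lambda>t. v + t *\<^sub>R axis i 1) has_derivative (\<lambda>s. s *\<^sub>R axis i 1)) (at t)"
    by (auto intro!: derivative_eq_intros)
  from has_derivative_compose[OF this D]
  have "((\<lambda>t. f (v + t *\<^sub>R axis i 1)) has_derivative (\<lambda>s. ?D (s *\<^sub>R axis i 1))) (at t)" .
  then show ?thesis
    unfolding has_field_derivative_def
    by (simp add: linear_cmul[OF has_derivative_linear[OF D]] partial_def mult_commute_abs)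
qed

text \<open>Two applications of the mean value theorem: along axis \<open>i\<close> to the increment
  of \<open>f\<close> in direction \<open>j\<close>, then along axis \<open>j\<close> to
  \<open>partial i f\<close>. The second difference on the left is symmetric in \<open>i\<close> and
  \<open>j\<close>, which is what allows the two derivatives to be exchanged;
  \<open>2 * s < d\<close> keeps all the points used inside the ball.\<close>

lemma second_difference_eq:
  fixes f :: "real^'n::finite \<Rightarrow> real"
  assumes C2: "Ck_on 2 f S" and ball: "ball u d \<subseteq> S" and s: "0 < s" "2 * s < d"
  obtains p where "dist p u < d"
    "f (u + s *\<^sub>R axis i 1 + s *\<^sub>R axis j 1) - f (u + s *\<^sub>R axis i 1) - f (u + s *\<^sub>R axis j 1) + f u
      = s\<^sup>2 * partial j (partial i f) p"
proof -
  have diff: "f differentiable (at p)" and diff': "partial i f differentiable (at p)" if "p \<in> S" for p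
    using C2 that by (auto simp: numeral_2_eq_2 Ck_on.simps(2))
  have near: "dist (u + t *\<^sub>R axis i 1 + r *\<^sub>R axis j 1) u < d"
    if "0 \<le> t" "t \<le> s" "0 \<le> r" "r \<le> s" for t r
  proof -
    have "dist (u + t *\<^sub>R axis i 1 + r *\<^sub>R axis j 1) u \<le> norm (t *\<^sub>R (axis i 1 :: real^'n)) + norm (r *\<^sub>R (axis j 1 :: real^'n))"
      using norm_triangle_ineq[of "t *\<^sub>R (axis i 1 :: real^'n)" "r *\<^sub>R axis j 1"]
      by (simp add: dist_norm add.assoc)
    then show ?thesis using that s by simp
  qed
  have inS: "u + t *\<^sub>R axis i 1 + r *\<^sub>R axis j 1 \<in> S"
    if "0 \<le> t" "t \<le> s" "0 \<le> r" "r \<le> s" for t r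
    using near[OF that] ball by (auto simp: dist_commute)
  define \<phi> where "\<phi> t = f (u + s *\<^sub>R axis j 1 + t *\<^sub>R axis i 1) - f (u + t *\<^sub>R axis i 1)" for t
  have "\<exists>z. 0 < z \<and> z < s \<and> \<phi> s - \<phi> 0 = (s - 0) *
      (partial i f (u + s *\<^sub>R axis j 1 + z *\<^sub>R axis i 1) - partial i f (u + z *\<^sub>R axis i 1))"
  proof (rule MVT2[OF s(1)])
    fix t assume t: "0 \<le> t" "t \<le> s"
    show "(\<phi> has_real_derivative
      partial i f (u + s *\<^sub>R axis j 1 + t *\<^sub>R axis i 1) - partial i f (u + t *\<^sub>R axis i 1)) (at t)"
      unfolding \<phi>_def
      by (intro DERIV_diff DERIV_along_line diff)
        (use inS[OF t, of s] inS[OF t, of 0] s in \<open>auto simp: algebra_simps\<close>)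
  qed
  then obtain z where z: "0 < z" "z < s" and 1: "\<phi> s - \<phi> 0 = s *
      (partial i f (u + s *\<^sub>R axis j 1 + z *\<^sub>R axis i 1) - partial i f (u + z *\<^sub>R axis i 1))"
    by auto
  define \<psi> where "\<psi> r = partial i f (u + z *\<^sub>R axis i 1 + r *\<^sub>R axis j 1)" for r
  have "\<exists>w. 0 < w \<and> w < s \<and> \<psi> s - \<psi> 0 = (s - 0) *
      partial j (partial i f) (u + z *\<^sub>R axis i 1 + w *\<^sub>R axis j 1)"
    by (rule MVT2[OF s(1)], unfold \<psi>_def)
      (intro DERIV_along_line diff' inS, use z s in auto)
  then obtain w where w: "0 < w" "w < s" and 2: "\<psi> s - \<psi> 0 = s *
      partial j (partial i f) (u + z *\<^sub>R axis i 1 + w *\<^sub>R axis j 1)"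
    by auto
  show thesis
  proof (rule that)
    show "dist (u + z *\<^sub>R axis i 1 + w *\<^sub>R axis j 1) u < d"
      using near z w by simp
    have "\<psi> s - \<psi> 0 = partial i f (u + s *\<^sub>R axis j 1 + z *\<^sub>R axis i 1) - partial i f (u + z *\<^sub>R axis i 1)"
      by (simp add: \<psi>_def add_ac)
    with 1 2 show "f (u + s *\<^sub>R axis i 1 + s *\<^sub>R axis j 1) - f (u + s *\<^sub>R axis i 1) - f (u + s *\<^sub>R axis j 1) + f u
      = s\<^sup>2 * partial j (partial i f) (u + z *\<^sub>R axis i 1 + w *\<^sub>R axis j 1)"
      by (simp add: \<phi>_def power2_eq_square add_ac)
  qed
qed

text \<open>By the symmetry of the second difference, the two mixed derivatives take a common value
  at two points arbitrarily near \<open>u\<close>. If they differed at \<open>u\<close>, continuity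
  would put this value at less than half the gap from both.\<close>

lemma partial_commute_real:
  fixes f :: "real^'n::finite \<Rightarrow> real"
  assumes C2: "Ck_on 2 f S" and S: "open S" "u \<in> S"
  shows "partial i (partial j f) u = partial j (partial i f) u"
proof (rule ccontr)
  let ?a = "partial i (partial j f)" and ?b = "partial j (partial i f)"
  assume "?a u \<noteq> ?b u"
  then have e: "\<bar>?a u - ?b u\<bar> / 2 > 0" by simp
  have "continuous_on S (partial k (partial l f))" for k l
    using C2 by (simp add: numeral_2_eq_2 Ck_on.simps(2))
  then have "isCont (partial k (partial l f)) u" for k l
    using S by (simp add: continuous_on_eq_continuous_at)
  then have "\<forall>e>0. \<exists>d>0. \<forall>p. dist p u < d \<longrightarrow>
      dist (partial k (partial l f) p) (partial k (partial l f) u) < e" for k l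
    by (simp add: continuous_at_eps_delta)
  then obtain d1 d2 where d1: "d1 > 0" "\<And>p. dist p u < d1 \<Longrightarrow> dist (?a p) (?a u) < \<bar>?a u - ?b u\<bar> / 2"
    and d2: "d2 > 0" "\<And>p. dist p u < d2 \<Longrightarrow> dist (?b p) (?b u) < \<bar>?a u - ?b u\<bar> / 2"
    using e by meson
  obtain d0 where d0: "d0 > 0" "ball u d0 \<subseteq> S"
    using S open_contains_ball by blast
  define d where "d = min d0 (min d1 d2)"
  have d: "d > 0" "ball u d \<subseteq> S"
    using d0 d1(1) d2(1) by (auto simp: d_def)
  define s where "s = d / 3"
  have s: "s > 0" "2 * s < d" using d by (auto simp: s_def)
  obtain p where p: "dist p u < d"
    "f (u + s *\<^sub>R axis i 1 + s *\<^sub>R axis j 1) - f (u + s *\<^sub>R axis i 1) - f (u + s *\<^sub>R axis j 1) + f u = s\<^sup>2 * ?b p"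
    using second_difference_eq[OF C2 d(2) s] .
  obtain p' where p': "dist p' u < d"
    "f (u + s *\<^sub>R axis j 1 + s *\<^sub>R axis i 1) - f (u + s *\<^sub>R axis j 1) - f (u + s *\<^sub>R axis i 1) + f u = s\<^sup>2 * ?a p'"
    using second_difference_eq[OF C2 d(2) s] .
  have "u + s *\<^sub>R axis j 1 + s *\<^sub>R axis i 1 = u + s *\<^sub>R axis i 1 + s *\<^sub>R axis j 1"
    by (simp add: add_ac)
  then have "s\<^sup>2 * ?b p = s\<^sup>2 * ?a p'"
    using p(2) p'(2)[unfolded \<open>_ = u + _ + _\<close>] by linarith
  then have "?b p = ?a p'" using s by simp
  moreover have "dist (?a p') (?a u) < \<bar>?a u - ?b u\<bar> / 2" "dist (?b p) (?b u) < \<bar>?a u - ?b u\<bar> / 2"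
    using d1(2) d2(2) p(1) p'(1) by (auto simp: d_def)
  ultimately have close: "\<bar>?b p - ?a u\<bar> < \<bar>?a u - ?b u\<bar> / 2" "\<bar>?b p - ?b u\<bar> < \<bar>?a u - ?b u\<bar> / 2"
    by (simp_all add: dist_real_def)
  have "False" if "\<bar>z - a\<bar> < \<bar>a - b\<bar> / 2" "\<bar>z - b\<bar> < \<bar>a - b\<bar> / 2" for z a b :: real
    using that by argo
  from this[OF close] show False .
qed

lemma partial_inner_const:
  fixes f :: "real^'n::finite \<Rightarrow> 'b::real_inner"
  assumes "f differentiable (at u)"
  shows "partial i (\<lambda>u. f u \<bullet> b) u = partial i f u \<bullet> b"
  using partial_inner[OF assms differentiable_const[of b], of i]
    partial_eq[OF has_derivative_const[of b], of i] by simp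

lemma partial_cong_open:
  assumes "open S" "u \<in> S" "\<And>u. u \<in> S \<Longrightarrow> f u = g u"
  shows "partial i f u = partial i g u"
proof -
  have "(f has_derivative D) (at u) \<longleftrightarrow> (g has_derivative D) (at u)" for D
    using has_derivative_transform_within_open[OF _ assms(1,2), of f D UNIV g]
      has_derivative_transform_within_open[OF _ assms(1,2), of g D UNIV f] assms(3) by auto
  then show ?thesis by (simp add: partial_def frechet_derivative_def)
qed

text \<open>Inner products with basis vectors carry the symmetry of real-valued second derivatives
  over to vector-valued maps.\<close>

lemma Ck_on_inner_const:
  fixes f :: "real^'n::finite \<Rightarrow> 'b::real_inner"
  assumes "Ck_on k f S" "open S"
  shows "Ck_on k (\<lambda>u. f u \<bullet> b) S"
  using assms(1)
proof (induction k arbitrary: f)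
  case 0
  then show ?case by (auto intro!: continuous_intros)
next
  case (Suc k)
  \<comment> \<open>\<open>partial i\<close> of the scalar function agrees with
    \<open>partial i f u \<bullet> b\<close> only on \<open>S\<close>, so the induction hypothesis
    must be transported along an equality that holds on \<open>S\<close> alone.\<close>
  have cong: "Ck_on k g S" if "Ck_on k f S" "\<And>u. u \<in> S \<Longrightarrow> f u = g u" for f g :: "real^'n \<Rightarrow> real"
    using that
  proof (induction k arbitrary: f g)
    case 0
    then show ?case using continuous_on_cong[OF refl, of S f g] by simp
  next
    case (Suc k)
    have "g differentiable (at u)" if "u \<in> S" for u
      using Suc.prems that assms(2) unfolding Ck_on.simps(2) differentiable_def
      by (metis has_derivative_transform_within_open)
    moreover have "Ck_on k (partial i g) S" for i
      by (rule Suc.IH[of "partial i f"])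
        (use Suc.prems assms(2) in \<open>auto simp: Ck_on.simps(2) intro: partial_cong_open\<close>)
    ultimately show ?case by (simp add: Ck_on.simps(2))
  qed
  have "(\<lambda>u. f u \<bullet> b) differentiable (at u)" if "u \<in> S" for u
    using Suc.prems that
    by (auto simp: Ck_on.simps(2) intro!: differentiable_inner)
  moreover have "Ck_on k (partial i (\<lambda>u. f u \<bullet> b)) S" for i
    using Suc.prems by (intro cong[OF Suc.IH]) (auto simp: Ck_on.simps(2) partial_inner_const)
  ultimately show ?case by (simp add: Ck_on.simps(2))
qed

text \<open>Componentwise from the real case. It is applied to the immersion, whose mixed
  derivatives must cancel in the divergence of the flux.\<close>

lemma partial_commute:
  fixes f :: "real^'n::finite \<Rightarrow> 'b::euclidean_space"
  assumes C2: "Ck_on 2 f S" and S: "open S" "u \<in> S"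
  shows "partial i (partial j f) u = partial j (partial i f) u"
proof (rule euclidean_eqI)
  fix b :: 'b
  have "partial k (partial l (\<lambda>u. f u \<bullet> b)) u = partial k (partial l f) u \<bullet> b" for k l
  proof -
    have "partial k (partial l (\<lambda>u. f u \<bullet> b)) u = partial k (\<lambda>u. partial l f u \<bullet> b) u"
      using C2 by (intro partial_cong_open[OF S] partial_inner_const)
        (auto simp: numeral_2_eq_2 Ck_on.simps(2))
    also have "\<dots> = partial k (partial l f) u \<bullet> b"
      using C2 S by (intro partial_inner_const) (auto simp: numeral_2_eq_2 Ck_on.simps(2))
    finally show ?thesis .
  qed
  then show "partial i (partial j f) u \<bullet> b = partial j (partial i f) u \<bullet> b"
    using partial_commute_real[OF Ck_on_inner_const[OF C2 S(1)] S] by metis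
qed

section \<open>Integrals of derivatives of compactly supported functions\<close>

lemma integrable_compact_support:
  fixes g :: "'a::euclidean_space \<Rightarrow> real"
  assumes "continuous_on UNIV g" "compact K" "\<And>u. u \<notin> K \<Longrightarrow> g u = 0"
  shows "integrable lborel g"
proof -
  have "integrable lborel (\<lambda>u. indicator K u *\<^sub>R g u)"
    using assms by (intro borel_integrable_compact continuous_on_subset[OF assms(1)]) auto
  also have "(\<lambda>u. indicator K u *\<^sub>R g u) = g"
    using assms(3) by (auto simp: fun_eq_iff indicator_def)
  finally show ?thesis .
qed

lemma bounded_compact_support:
  fixes g :: "'a::euclidean_space \<Rightarrow> real"
  assumes "continuous_on UNIV g" "compact K" "\<And>u. u \<notin> K \<Longrightarrow> g u = 0"
  obtains B where "B \<ge> 0" "\<And>u. \<bar>g u\<bar> \<le> B"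
proof -
  have "bounded (g ` K)"
    using assms by (intro compact_imp_bounded compact_continuous_image continuous_on_subset[OF assms(1)]) auto
  then obtain B where B: "\<And>u. u \<in> K \<Longrightarrow> \<bar>g u\<bar> \<le> B"
    by (auto simp: bounded_iff)
  have "\<bar>g u\<bar> \<le> max B 0" for u
    using B[of u] assms(3)[of u] by (cases "u \<in> K") auto
  then show thesis by (intro that[of "max B 0"]) auto
qed

text \<open>Translation invariance gives every difference quotient of \<open>g\<close> integral
  zero, and dominated convergence passes to the limit. The mean value theorem bounds the quotients
  by the bound of \<open>partial i g\<close>.\<close>

lemma integral_partial_compact_support:
  fixes g :: "real^'n::finite \<Rightarrow> real"
  assumes g: "Ck_on 1 g UNIV" and K: "compact K" and g0: "\<And>u. u \<notin> K \<Longrightarrow> g u = 0"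
  shows "integral\<^sup>L lborel (partial i g) = 0"
proof -
  let ?e = "axis i 1 :: real^'n"
  have p0: "partial i g u = 0" if "u \<notin> K" for u
    using partial_cong_open[of "- K" u g "\<lambda>_. 0" i] that K g0 partial_eq[OF has_derivative_const, of i 0 u]
    by (simp add: open_Compl compact_imp_closed)
  have cp: "continuous_on UNIV (partial i g)"
    using g by (rule C1_continuous_partial)
  have cg: "continuous_on UNIV g" using g by (rule C1_continuous)
  obtain B where B: "B \<ge> 0" "\<And>u. \<bar>partial i g u\<bar> \<le> B"
    using bounded_compact_support[OF cp K p0] by blast
  define h :: "nat \<Rightarrow> real" where "h n = 1 / real (Suc n)" for n
  have h: "0 < h n" "h n \<le> 1" for n by (auto simp: h_def)
  define s where "s n u = (g (u + h n *\<^sub>R ?e) - g u) / h n" for n u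
  \<comment> \<open>As \<open>0 < h n \<le> 1\<close>, sweeping \<open>K\<close> backwards by at
    most one unit along the axis yields a compact set outside which all quotients \<open>s n\<close>
    vanish.\<close>
  define K' where "K' = (\<lambda>(k, t). k - t *\<^sub>R ?e) ` (K \<times> {0..1::real})"
  have K': "compact K'"
    unfolding K'_def using K
    by (intro compact_continuous_image compact_Times) (auto intro!: continuous_intros simp: case_prod_unfold)
  have s_out: "s n u = 0" if "u \<notin> K'" for n u
  proof -
    have "u \<notin> K"
    proof
      assume "u \<in> K"
      then have "u \<in> K'" unfolding K'_def by (intro image_eqI[of _ _ "(u, 0)"]) auto
      with that show False ..
    qed
    moreover have "u + h n *\<^sub>R ?e \<notin> K"
    proof
      assume "u + h n *\<^sub>R ?e \<in> K"
      then have "u \<in> K'" unfolding K'_def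
        using h[of n] by (intro image_eqI[of _ _ "(u + h n *\<^sub>R ?e, h n)"]) auto
      with that show False ..
    qed
    ultimately show ?thesis by (simp add: s_def g0)
  qed
  have s_bound: "\<bar>s n u\<bar> \<le> B" for n u
  proof -
    have "\<exists>z. 0 < z \<and> z < h n \<and> g (u + h n *\<^sub>R ?e) - g (u + 0 *\<^sub>R ?e) = (h n - 0) * partial i g (u + z *\<^sub>R ?e)"
      by (rule MVT2[OF h(1)]) (intro DERIV_along_line C1_differentiable[OF g], simp)
    then obtain z where "g (u + h n *\<^sub>R ?e) - g u = h n * partial i g (u + z *\<^sub>R ?e)" by auto
    then show ?thesis using h(1)[of n] B(2) by (simp add: s_def)
  qed
  have "(\<lambda>n. integral\<^sup>L lborel (s n)) \<longlonglongrightarrow> integral\<^sup>L lborel (partial i g)"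
  proof (rule integral_dominated_convergence[where w = "\<lambda>u. B * indicator K' u"])
    show "partial i g \<in> borel_measurable lborel"
      using cp borel_measurable_continuous_onI by simp
    have "continuous_on UNIV (s n)" for n
      unfolding s_def using h(1)[of n]
      by (auto intro!: continuous_intros continuous_on_compose2[OF cg])
    then show "s n \<in> borel_measurable lborel" for n
      by (simp add: borel_measurable_continuous_onI)
    show "integrable lborel (\<lambda>u. B * indicator K' u)"
      using K' emeasure_bounded_finite[OF compact_imp_bounded[OF K']]
      by (intro integrable_mult_right integrable_real_indicator) (auto simp: compact_imp_closed)
    have h0: "filterlim h (at 0) sequentially"
      unfolding h_def filterlim_at using LIMSEQ_inverse_real_of_nat
      by (auto simp: inverse_eq_divide)
    show "AE u in lborel. (\<lambda>n. s n u) \<longlonglongrightarrow> partial i g u"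
    proof (rule AE_I2)
      fix u
      have "((\<lambda>t. g (u + t *\<^sub>R ?e)) has_real_derivative partial i g (u + 0 *\<^sub>R ?e)) (at 0)"
        by (intro DERIV_along_line C1_differentiable[OF g]) simp
      then have "((\<lambda>t. (g (u + t *\<^sub>R ?e) - g u) / t) \<longlongrightarrow> partial i g u) (at 0)"
        by (simp add: has_field_derivative_iff)
      from filterlim_compose[OF this h0] show "(\<lambda>n. s n u) \<longlonglongrightarrow> partial i g u"
        by (simp add: s_def)
    qed
    show "AE u in lborel. norm (s n u) \<le> B * indicator K' u" for n
      using s_bound s_out by (auto simp: indicator_def)
  qed
  moreover have "integral\<^sup>L lborel (s n) = 0" for n
  proof -
    have ig: "integrable lborel g" by (rule integrable_compact_support[OF cg K g0])
    have m: "g \<in> borel_measurable borel" by (rule borel_measurable_continuous_onI[OF cg])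
    have d: "distr lborel borel ((+) (h n *\<^sub>R ?e)) = lborel" by (rule lborel_distr_plus)
    have "integrable (distr lborel borel ((+) (h n *\<^sub>R ?e))) g" using ig by (simp add: d)
    then have i1: "integrable lborel (\<lambda>u. g (u + h n *\<^sub>R ?e))"
      using m by (subst (asm) integrable_distr_eq) (auto simp: add.commute)
    have "integral\<^sup>L (distr lborel borel ((+) (h n *\<^sub>R ?e))) g = integral\<^sup>L lborel (\<lambda>u. g (h n *\<^sub>R ?e + u))"
      using m by (intro integral_distr) auto
    then have "integral\<^sup>L lborel (\<lambda>u. g (u + h n *\<^sub>R ?e)) = integral\<^sup>L lborel g"
      by (simp add: d add.commute)
    then show ?thesis using ig i1 by (simp add: s_def[abs_def])
  qed
  ultimately show ?thesis by (simp add: LIMSEQ_const_iff)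
qed

text \<open>Extension by zero is of class C^1 on the whole space because \<open>S\<close> and the
  complement of \<open>K\<close> are open and cover it. The indicator is there since nothing is
  known of \<open>f\<close> outside \<open>S\<close>, as happens with coordinate
  expressions.\<close>

lemma integral_partial_compact_support_open:
  fixes f :: "real^'n::finite \<Rightarrow> real"
  assumes S: "open S" and f: "Ck_on 1 f S" and K: "compact K" "K \<subseteq> S"
    and f0: "\<And>u. u \<in> S - K \<Longrightarrow> f u = 0"
  shows "integrable lborel (\<lambda>u. indicator S u * partial i f u)"
    "(LINT u|lborel. indicator S u * partial i f u) = 0"
proof -
  define g where "g u = (if u \<in> S then f u else 0)" for u
  have oK: "open (- K)" using K(1) by (simp add: open_Compl compact_imp_closed)
  have g0: "g u = 0" if "u \<notin> K" for u using f0 that by (simp add: g_def)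
  have "Ck_on 1 g S" by (rule C1_transform_open[OF f S]) (simp add: g_def)
  moreover have "Ck_on 1 g (- K)"
    by (rule C1_transform_open[OF C1_const[of 0] oK]) (simp add: g0)
  ultimately have "Ck_on 1 g (S \<union> - K)" using S oK by (rule C1_Un_open)
  moreover have "S \<union> - K = UNIV" using K(2) by blast
  ultimately have g1: "Ck_on 1 g UNIV" by simp
  have p0: "partial i g u = 0" if "u \<notin> K" for u
    using partial_cong_open[OF oK, of u g "\<lambda>_. 0" i] that g0 partial_eq[OF has_derivative_const, of i 0 u]
    by simp
  have eq: "partial i g = (\<lambda>u. indicator S u * partial i f u)"
  proof
    fix u
    show "partial i g u = indicator S u * partial i f u"
    proof (cases "u \<in> S")
      case True
      then show ?thesis using partial_cong_open[OF S True, of g f i] by (simp add: g_def)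
    next
      case False
      then show ?thesis using p0[of u] K(2) by auto
    qed
  qed
  show "integrable lborel (\<lambda>u. indicator S u * partial i f u)"
    unfolding eq[symmetric] by (rule integrable_compact_support[OF C1_continuous_partial[OF g1] K(1) p0])
  show "(LINT u|lborel. indicator S u * partial i f u) = 0"
    unfolding eq[symmetric] by (rule integral_partial_compact_support[OF g1 K(1) g0])
qed

subsection \<open>Charts and partitions of unity\<close>

abbreviation chart_inv :: "'a chart \<Rightarrow> real^2 \<Rightarrow> 'a" where
  "chart_inv c \<equiv> inv_into (fst c) (snd c)"

abbreviation chart_range :: "'a chart \<Rightarrow> (real^2) set" where
  "chart_range c \<equiv> snd c ` fst c"

lemma local_rep_apply: "local_rep c f u = f (chart_inv c u)"
  by (simp add: local_rep_def)

locale C1_surface =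
  fixes M :: "'a::t2_space set" and A :: "'a chart set"
  assumes atlas: "Ck_atlas 1 M A" and compact_M: "compact M"
begin

lemma charts_cover: "(\<Union>c\<in>A. fst c) = M"
  using atlas by (simp add: Ck_atlas_def)

lemma chart_on: "c \<in> A \<Longrightarrow> chart_on M c"
  using atlas by (simp add: Ck_atlas_def)

lemma openin_chart: "c \<in> A \<Longrightarrow> openin (top_of_set M) (fst c)"
  using chart_on by (simp add: chart_on_def)

lemma chart_subset: "c \<in> A \<Longrightarrow> fst c \<subseteq> M"
  using charts_cover by blast

lemma open_chart_range: "c \<in> A \<Longrightarrow> open (chart_range c)"
  using chart_on by (simp add: chart_on_def)

text \<open>\<open>chart_on\<close> provides some continuous inverse, while \<open>local_rep\<close>
  is built from \<open>inv_into\<close>; on the chart range the two agree.\<close>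

lemma homeomorphism_chart:
  assumes "c \<in> A"
  shows "homeomorphism (fst c) (chart_range c) (snd c) (chart_inv c)"
proof -
  obtain \<psi> where \<psi>: "homeomorphism (fst c) (chart_range c) (snd c) \<psi>"
    using chart_on[OF assms] by (auto simp: chart_on_def)
  then have inj: "inj_on (snd c) (fst c)"
    by (auto simp: homeomorphism_def intro: inj_on_inverseI)
  have "\<psi> u = chart_inv c u" if "u \<in> chart_range c" for u
    using that \<psi> inj by (auto simp: homeomorphism_def)
  then show ?thesis
    using \<psi> by (auto intro: homeomorphism_cong)
qed

lemma inj_on_chart: "c \<in> A \<Longrightarrow> inj_on (snd c) (fst c)"
  by (drule homeomorphism_chart) (auto simp: homeomorphism_def intro!: inj_on_inverseI[of "fst c" "chart_inv c"])

lemma chart_inv_chart [simp]: "c \<in> A \<Longrightarrow> p \<in> fst c \<Longrightarrow> chart_inv c (snd c p) = p"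
  by (simp add: inj_on_chart)

lemma chart_chart_inv [simp]: "u \<in> chart_range c \<Longrightarrow> snd c (chart_inv c u) = u"
  by (rule f_inv_into_f)

lemma chart_inv_in [simp]: "u \<in> chart_range c \<Longrightarrow> chart_inv c u \<in> fst c"
  by (rule inv_into_into)

lemma local_rep_chart [simp]: "c \<in> A \<Longrightarrow> p \<in> fst c \<Longrightarrow> local_rep c f (snd c p) = f p"
  by (simp add: local_rep_apply)

lemma continuous_on_chart: "c \<in> A \<Longrightarrow> continuous_on (fst c) (snd c)"
  using homeomorphism_chart by (simp add: homeomorphism_def)

lemma continuous_on_chart_inv: "c \<in> A \<Longrightarrow> continuous_on (chart_range c) (chart_inv c)"
  using homeomorphism_chart by (simp add: homeomorphism_def)

lemma open_chart_image:
  assumes "c \<in> A" "openin (top_of_set M) W"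
  shows "open (snd c ` (fst c \<inter> W))"
proof -
  have "openin (top_of_set (fst c)) (fst c \<inter> W)"
    using openin_subtopology_Int2[OF assms(2), of "fst c"] chart_subset[OF assms(1)]
    by (simp add: subtopology_subtopology inf.absorb2 inf_commute)
  then have "openin (top_of_set (chart_range c)) (snd c ` (fst c \<inter> W))"
    using homeomorphism_imp_open_map[OF homeomorphism_chart[OF assms(1)]] by blast
  then show ?thesis
    using open_chart_range[OF assms(1)] openin_open_eq by blast
qed

lemma openin_chart_preimage:
  assumes "c \<in> A" "open V"
  shows "openin (top_of_set M) (fst c \<inter> snd c -` V)"
  using continuous_openin_preimage_gen[OF continuous_on_chart[OF assms(1)] assms(2)]
    openin_chart[OF assms(1)] openin_trans by blast

lemma open_overlap: "c \<in> A \<Longrightarrow> d \<in> A \<Longrightarrow> open (snd c ` (fst c \<inter> fst d))"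
  by (intro open_chart_image openin_chart)

lemma C1_transition: "c \<in> A \<Longrightarrow> d \<in> A \<Longrightarrow> Ck_on 1 (local_rep c (snd d)) (snd c ` (fst c \<inter> fst d))"
  using atlas by (simp add: Ck_atlas_def)

lemma chart_at:
  assumes "p \<in> M"
  shows "chart_at A p \<in> A" "p \<in> fst (chart_at A p)"
proof -
  have "\<exists>c. c \<in> A \<and> p \<in> fst c" using assms charts_cover by blast
  then show "chart_at A p \<in> A" "p \<in> fst (chart_at A p)"
    using someI_ex[of "\<lambda>c. c \<in> A \<and> p \<in> fst c"] unfolding chart_at_def by auto
qed

text \<open>The chain rule for the transition map: near \<open>snd c p\<close> the expression in
  \<open>c\<close> is the one in \<open>d\<close> composed with it.\<close>

lemma partial_local_rep_overlap:
  assumes c: "c \<in> A" "p \<in> fst c" and d: "d \<in> A" "p \<in> fst d"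
    and f: "local_rep d f differentiable (at (snd d p))"
  shows "partial i (local_rep c f) (snd c p)
    = (\<Sum>j\<in>UNIV. partial i (local_rep c (snd d)) (snd c p) $ j *\<^sub>R partial j (local_rep d f) (snd d p))"
proof -
  let ?S = "snd c ` (fst c \<inter> fst d)"
  have S: "open ?S" "snd c p \<in> ?S" using c d open_overlap by auto
  have "partial i (local_rep c f) (snd c p) = partial i (\<lambda>u. local_rep d f (local_rep c (snd d) u)) (snd c p)"
    by (rule partial_cong_open[OF S]) (use c(1) d(1) in \<open>auto simp: local_rep_apply\<close>)
  also have "\<dots> = (\<Sum>j\<in>UNIV. partial i (local_rep c (snd d)) (snd c p) $ j *\<^sub>R
      partial j (local_rep d f) (local_rep c (snd d) (snd c p)))"
    by (rule partial_compose)
      (use c d f C1_differentiable[OF C1_transition[OF c(1) d(1)] S(2)] in auto)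
  finally show ?thesis using c by simp
qed

definition C1_on_surface :: "('a \<Rightarrow> 'b::real_normed_vector) \<Rightarrow> bool" where
  "C1_on_surface f \<longleftrightarrow> (\<forall>c\<in>A. Ck_on 1 (local_rep c f) (chart_range c))"

lemma C1_on_surfaceD: "C1_on_surface f \<Longrightarrow> c \<in> A \<Longrightarrow> Ck_on 1 (local_rep c f) (chart_range c)"
  by (simp add: C1_on_surface_def)

text \<open>A compact set in a Hausdorff space is closed, so in any chart \<open>d\<close> the
  overlap with \<open>c\<close> and the part off \<open>K\<close> have open images that cover the
  range. The function is a C^1 composition on the first and zero on the second.\<close>

lemma C1_on_surface_extend_zero:
  assumes c: "c \<in> A" and K: "compact K" "K \<subseteq> fst c"
    and \<beta>: "Ck_on 1 \<beta> (chart_range c)" "\<And>q. q \<in> fst c - K \<Longrightarrow> \<beta> (snd c q) = 0"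
  shows "C1_on_surface (\<lambda>q. if q \<in> fst c then \<beta> (snd c q) else 0)"
  unfolding C1_on_surface_def
proof
  fix d assume d: "d \<in> A"
  let ?b = "\<lambda>q. if q \<in> fst c then \<beta> (snd c q) else 0"
  let ?S = "snd d ` (fst d \<inter> fst c)" and ?T = "snd d ` (fst d \<inter> (M - K))"
  have "closedin (top_of_set M) K"
    using K chart_subset[OF c] by (auto intro!: closed_subset compact_imp_closed)
  then have "openin (top_of_set M) (M - K)"
    by (metis openin_diff openin_subtopology_self)
  then have oT: "open ?T" by (rule open_chart_image[OF d])
  have oS: "open ?S" using c d by (rule open_overlap[rotated])
  have "Ck_on 1 (\<lambda>u. \<beta> (local_rep d (snd c) u)) ?S"
    by (rule C1_compose[OF \<beta>(1) C1_transition[OF d c]]) (use c d in auto)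
  then have "Ck_on 1 (local_rep d ?b) ?S"
    by (rule C1_transform_open[OF _ oS]) (use c d in \<open>auto simp: local_rep_apply\<close>)
  moreover have "Ck_on 1 (local_rep d ?b) ?T"
    by (rule C1_transform_open[OF C1_const[of 0] oT]) (use d \<beta>(2) in \<open>auto simp: local_rep_apply\<close>)
  ultimately have "Ck_on 1 (local_rep d ?b) (?S \<union> ?T)"
    using oS oT by (rule C1_Un_open)
  moreover have "?S \<union> ?T = chart_range d"
    using K(2) chart_subset[OF d] by blast
  ultimately show "Ck_on 1 (local_rep d ?b) (chart_range d)" by simp
qed

lemma C1_on_surface_sum:
  "finite I \<Longrightarrow> (\<And>i. i \<in> I \<Longrightarrow> C1_on_surface (f i)) \<Longrightarrow> C1_on_surface (\<lambda>p. \<Sum>i\<in>I. f i p)"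
  unfolding C1_on_surface_def local_rep_def o_def by (auto intro!: C1_sum)

lemma C1_on_surface_mult:
  fixes f g :: "'a \<Rightarrow> real"
  shows "C1_on_surface f \<Longrightarrow> C1_on_surface g \<Longrightarrow> C1_on_surface (\<lambda>p. f p * g p)"
  unfolding C1_on_surface_def local_rep_def o_def by (auto intro!: C1_mult)

lemma C1_on_surface_divide:
  fixes f g :: "'a \<Rightarrow> real"
  assumes "C1_on_surface f" "C1_on_surface g" "\<And>p. p \<in> M \<Longrightarrow> g p \<noteq> 0"
  shows "C1_on_surface (\<lambda>p. f p / g p)"
  unfolding C1_on_surface_def
proof
  fix c assume c: "c \<in> A"
  have "chart_inv c u \<in> M" if "u \<in> chart_range c" for u
    using chart_inv_in[OF that] chart_subset[OF c] by blast
  then show "Ck_on 1 (local_rep c (\<lambda>p. f p / g p)) (chart_range c)"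
    using assms c unfolding C1_on_surface_def local_rep_def o_def by (intro C1_divide) auto
qed

end

text \<open>For \<open>\<rho> > 0\<close> it is positive exactly on the open ball of radius
  \<open>\<rho>\<close>. Truncation at zero leaves a corner on the bounding circle, and squaring
  smooths it to class C^1, which is what the divergence theorem in a chart asks of a cut-off
  function.\<close>

definition bump :: "real^2 \<Rightarrow> real \<Rightarrow> real^2 \<Rightarrow> real" where
  "bump u0 \<rho> u = (max 0 (\<rho>\<^sup>2 - (u - u0) \<bullet> (u - u0)))\<^sup>2"

lemma DERIV_max_squared: "((\<lambda>t::real. (max 0 t)\<^sup>2) has_real_derivative 2 * max 0 t) (at t)"
proof -
  consider "t > 0" | "t < 0" | "t = 0" by linarith
  then show ?thesis
  proof cases
    case 1
    have "((\<lambda>t::real. t\<^sup>2) has_real_derivative 2 * t) (at t)"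
      by (auto intro!: derivative_eq_intros)
    then have "((\<lambda>t::real. (max 0 t)\<^sup>2) has_real_derivative 2 * t) (at t)"
      by (rule has_field_derivative_transform_within_open[where S = "{0<..}"]) (use 1 in auto)
    then show ?thesis using 1 by simp
  next
    case 2
    have "((\<lambda>t::real. (max 0 t)\<^sup>2) has_real_derivative 0) (at t)"
      by (rule has_field_derivative_transform_within_open[OF DERIV_const[of 0], where S = "{..<0}"])
        (use 2 in auto)
    then show ?thesis using 2 by simp
  next
    case 3
    \<comment> \<open>At the corner the difference quotient of the squared truncation is
      \<open>max 0 h\<close> itself.\<close>
    have "((\<lambda>h::real. max 0 h) \<longlongrightarrow> max 0 0) (at 0)"
      by (intro tendsto_intros)
    moreover have "\<forall>\<^sub>F h in at 0. max 0 h = (max 0 h)\<^sup>2 / (h::real)"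
      by (rule eventually_at_filter[THEN iffD2]) (auto simp: max_def power2_eq_square)
    ultimately have "((\<lambda>h::real. (max 0 h)\<^sup>2 / h) \<longlongrightarrow> 0) (at 0)"
      by (auto elim: tendsto_cong[THEN iffD1, rotated])
    then show ?thesis using 3 by (simp add: DERIV_def)
  qed
qed

lemma C1_bump: "Ck_on 1 (bump u0 \<rho>) S"
proof -
  have "Ck_on 1 (\<lambda>u. u) (UNIV :: (real^2) set)"
    by (rule C1_I[where f' = "\<lambda>_ v. v"]) auto
  then have "Ck_on 1 (\<lambda>u. u + - u0) (UNIV :: (real^2) set)"
    by (rule C1_add[OF _ C1_const])
  from this this have "Ck_on 1 (\<lambda>u. \<rho>\<^sup>2 + - 1 * ((u + - u0) \<bullet> (u + - u0))) (UNIV :: (real^2) set)"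
    by (rule C1_add[OF C1_const C1_mult[OF C1_const C1_inner]])
  then have "Ck_on 1 (\<lambda>u. (max 0 (\<rho>\<^sup>2 + - 1 * ((u + - u0) \<bullet> (u + - u0))))\<^sup>2) (UNIV :: (real^2) set)"
    by (rule C1_real_compose) (auto intro!: DERIV_max_squared continuous_intros)
  then show ?thesis
    unfolding bump_def[abs_def] by (intro Ck_on_subset[OF _ subset_UNIV[of S]]) simp
qed

lemma bump_nonneg: "0 \<le> bump u0 \<rho> u"
  by (simp add: bump_def)

lemma bump_pos:
  assumes "u \<in> ball u0 \<rho>"
  shows "0 < bump u0 \<rho> u"
proof -
  have "norm (u - u0) < \<rho>" using assms by (simp add: dist_norm norm_minus_commute)
  then have "(norm (u - u0))\<^sup>2 < \<rho>\<^sup>2" by (intro power_strict_mono) auto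
  then show ?thesis by (simp add: bump_def power2_norm_eq_inner)
qed

lemma bump_zero:
  assumes "u \<notin> cball u0 \<rho>" "\<rho> > 0"
  shows "bump u0 \<rho> u = 0"
proof -
  have "\<rho> < norm (u - u0)" using assms by (simp add: dist_norm norm_minus_commute)
  then have "\<rho>\<^sup>2 < (norm (u - u0))\<^sup>2" using assms by (intro power_strict_mono) auto
  then show ?thesis by (simp add: bump_def power2_norm_eq_inner)
qed

context C1_surface
begin

text \<open>Bumps on coordinate balls around finitely many points whose open balls cover
  \<open>M\<close>, divided by their sum, which the cover makes positive. The index set consists of
  the centres, and \<open>K t\<close> is the closed coordinate ball, so each piece has compact
  support inside a single chart.\<close>

lemma partition_of_unity:
  obtains I :: "'a set" and c :: "'a \<Rightarrow> 'a chart" and K :: "'a \<Rightarrow> 'a set" and \<psi> :: "'a \<Rightarrow> 'a \<Rightarrow> real"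
  where "finite I" "\<forall>t\<in>I. c t \<in> A \<and> compact (K t) \<and> K t \<subseteq> fst (c t)"
    "\<forall>t\<in>I. C1_on_surface (\<psi> t) \<and> (\<forall>q\<in>M - K t. \<psi> t q = 0)"
    "\<forall>q\<in>M. (\<Sum>t\<in>I. \<psi> t q) = 1"
proof -
  let ?c = "chart_at A"
  have "\<exists>\<rho>>0. cball (snd (?c p) p) \<rho> \<subseteq> chart_range (?c p)" if "p \<in> M" for p
    using open_chart_range[OF chart_at(1)[OF that]] chart_at(2)[OF that]
    by (auto simp: open_contains_cball)
  then obtain \<rho> where \<rho>: "\<And>p. p \<in> M \<Longrightarrow> \<rho> p > 0"
      "\<And>p. p \<in> M \<Longrightarrow> cball (snd (?c p) p) (\<rho> p) \<subseteq> chart_range (?c p)"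
    by metis
  define K where "K p = chart_inv (?c p) ` cball (snd (?c p) p) (\<rho> p)" for p
  define b where "b p q = (if q \<in> fst (?c p) then bump (snd (?c p) p) (\<rho> p) (snd (?c p) q) else 0)" for p q
  define W where "W p = fst (?c p) \<inter> snd (?c p) -` ball (snd (?c p) p) (\<rho> p)" for p
  have K: "compact (K p)" "K p \<subseteq> fst (?c p)" if "p \<in> M" for p
    unfolding K_def using \<rho>(2)[OF that] continuous_on_chart_inv[OF chart_at(1)[OF that]]
    by (auto intro!: compact_continuous_image intro: continuous_on_subset)
  have out: "bump (snd (?c p) p) (\<rho> p) (snd (?c p) q) = 0" if p: "p \<in> M" and q: "q \<in> fst (?c p) - K p" for p q
  proof (rule bump_zero)
    show "snd (?c p) q \<notin> cball (snd (?c p) p) (\<rho> p)"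
    proof
      assume "snd (?c p) q \<in> cball (snd (?c p) p) (\<rho> p)"
      then have "chart_inv (?c p) (snd (?c p) q) \<in> K p" unfolding K_def by blast
      then show False using q chart_at(1)[OF p] by simp
    qed
  qed (use \<rho> p in simp)
  have b_C1: "C1_on_surface (b p)" if "p \<in> M" for p
    unfolding b_def[abs_def]
    by (rule C1_on_surface_extend_zero[OF chart_at(1)[OF that] K[OF that] C1_bump out[OF that]])
  have b_out: "b p q = 0" if "p \<in> M" "q \<notin> K p" for p q
    using out that by (auto simp: b_def)
  have b_nonneg: "0 \<le> b p q" for p q by (simp add: b_def bump_nonneg)
  have b_pos: "0 < b p q" if "q \<in> W p" for p q
    using that bump_pos by (auto simp: b_def W_def)
  have W: "openin (top_of_set M) (W p)" "p \<in> W p" if "p \<in> M" for p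
    unfolding W_def using openin_chart_preimage chart_at \<rho> that by auto
  have "\<exists>D\<subseteq>W ` M. finite D \<and> M \<subseteq> \<Union>D"
    using W by (intro compact_M[unfolded compact_eq_openin_cover, rule_format]) auto
  then obtain D where D: "D \<subseteq> W ` M" "finite D" "M \<subseteq> \<Union>D" by blast
  obtain I where I: "I \<subseteq> M" "finite I" "M \<subseteq> (\<Union>p\<in>I. W p)"
    using finite_subset_image[OF D(2,1)] D(3) by blast
  let ?s = "\<lambda>q. \<Sum>p\<in>I. b p q"
  have s_pos: "?s q > 0" if q: "q \<in> M" for q
  proof -
    obtain p where p: "p \<in> I" "q \<in> W p" using I(3) q by auto
    have "0 < b p q" using p(2) by (rule b_pos)
    also have "\<dots> \<le> ?s q" using p(1) I(2) b_nonneg by (intro member_le_sum) auto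
    finally show ?thesis .
  qed
  show thesis
  proof (rule that[of I ?c K "\<lambda>p q. b p q / ?s q"])
    have "C1_on_surface (\<lambda>q. b t q / ?s q)" if "t \<in> I" for t
      using that I b_C1 s_pos
      by (intro C1_on_surface_divide C1_on_surface_sum) (auto simp: order.strict_implies_not_eq[symmetric])
    then show "\<forall>t\<in>I. C1_on_surface (\<lambda>q. b t q / ?s q) \<and> (\<forall>q\<in>M - K t. b t q / ?s q = 0)"
      using I(1) b_out by auto
    have "(\<Sum>t\<in>I. b t q / ?s q) = 1" if "q \<in> M" for q
      using s_pos[OF that] by (simp flip: sum_divide_distrib)
    then show "\<forall>q\<in>M. (\<Sum>t\<in>I. b t q / ?s q) = 1" by blast
    show "\<forall>t\<in>I. ?c t \<in> A \<and> compact (K t) \<and> K t \<subseteq> fst (?c t)"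
      using I(1) K chart_at(1) by blast
  qed (use I in auto)
qed

end

subsection \<open>Measures given by a density in every chart\<close>

lemma nn_integral_eq_integral_lebesgue:
  fixes f :: "'a::euclidean_space \<Rightarrow> real"
  assumes "f absolutely_integrable_on S" "\<And>u. u \<in> S \<Longrightarrow> 0 \<le> f u"
  shows "(\<integral>\<^sup>+u\<in>S. ennreal (f u) \<partial>lborel) = ennreal (integral S f)"
proof -
  have "(\<integral>\<^sup>+u\<in>S. ennreal (f u) \<partial>lborel) = (\<integral>\<^sup>+u\<in>S. ennreal (f u) \<partial>lebesgue)"
    by (simp add: nn_integral_completion)
  also have "\<dots> = (\<integral>\<^sup>+u. ennreal (indicator S u *\<^sub>R f u) \<partial>lebesgue)"
    by (intro nn_integral_cong) (auto simp: indicator_def)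
  also have "\<dots> = ennreal (LINT u:S|lebesgue. f u)"
    unfolding set_lebesgue_integral_def
    using assms by (intro nn_integral_eq_integral) (auto simp: set_integrable_def indicator_def)
  also have "\<dots> = ennreal (integral S f)"
    using set_lebesgue_integral_eq_integral(2)[OF assms(1)] by simp
  finally show ?thesis .
qed

text \<open>Contrapositive: a finite value together with Borel measurability would give absolute
  integrability.\<close>

lemma nn_integral_not_absolutely_integrable:
  fixes f :: "'a::euclidean_space \<Rightarrow> real"
  assumes "\<not> f absolutely_integrable_on S" "\<And>u. u \<in> S \<Longrightarrow> 0 \<le> f u"
    and m: "(\<lambda>u. indicator S u *\<^sub>R f u) \<in> borel_measurable borel"
  shows "(\<integral>\<^sup>+u\<in>S. ennreal (f u) \<partial>lborel) = \<infinity>"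
proof (rule ccontr)
  assume "(\<integral>\<^sup>+u\<in>S. ennreal (f u) \<partial>lborel) \<noteq> \<infinity>"
  moreover have "(\<integral>\<^sup>+u\<in>S. ennreal (f u) \<partial>lborel) = (\<integral>\<^sup>+u. ennreal (indicator S u *\<^sub>R f u) \<partial>lborel)"
    by (intro nn_integral_cong) (auto simp: indicator_def)
  ultimately have "integrable lborel (\<lambda>u. indicator S u *\<^sub>R f u)"
    using m assms(2) by (intro integrableI_nonneg) (auto simp: indicator_def less_top)
  then have "f absolutely_integrable_on S"
    unfolding set_integrable_def by (rule integrable_completion[THEN iffD2, rotated]) (use m in simp)
  with assms(1) show False ..
qed

text \<open>The substitution rule for absolutely integrable functions settles the finite case. It
  also says that both sides are integrable together, so in the other case both nonnegative integrals
  are infinite. \<open>h\<close> is kept apart from the pulled-back integrand because the two are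
  compared on \<open>S\<close> only.\<close>

lemma nn_integral_change_of_variables:
  fixes g :: "real^'n::{finite,wellorder} \<Rightarrow> real^'n::_" and f :: "real^'n::_ \<Rightarrow> real"
  assumes S: "S \<in> sets borel"
    and der: "\<And>u. u \<in> S \<Longrightarrow> (g has_derivative g' u) (at u within S)"
    and inj: "inj_on g S"
    and h: "\<And>u. u \<in> S \<Longrightarrow> h u = \<bar>det (matrix (g' u))\<bar> * f (g u)"
    and f0: "\<And>v. v \<in> g ` S \<Longrightarrow> 0 \<le> f v"
    and mf: "(\<lambda>v. indicator (g ` S) v *\<^sub>R f v) \<in> borel_measurable borel"
    and mh: "(\<lambda>u. indicator S u *\<^sub>R h u) \<in> borel_measurable borel"
  shows "(\<integral>\<^sup>+v\<in>g ` S. ennreal (f v) \<partial>lborel) = (\<integral>\<^sup>+u\<in>S. ennreal (h u) \<partial>lborel)"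
proof -
  let ?h = "\<lambda>u. \<bar>det (matrix (g' u))\<bar> * f (g u)"
  have cov: "?h absolutely_integrable_on S \<and> integral S ?h = b
      \<longleftrightarrow> f absolutely_integrable_on (g ` S) \<and> integral (g ` S) f = b" for b
  proof -
    have "S \<in> sets lebesgue" using S by simp
    \<comment> \<open>The rule is stated for vector-valued integrands, hence the detour through
      vectors with one component.\<close>
    from has_absolute_integral_change_of_variables[OF this der inj, where f = "\<lambda>v. vec (f v) :: real^1" and b = "vec b"]
    show ?thesis
      by (simp add: absolutely_integrable_on_1_iff integral_on_1_eq vec_eq_iff)
  qed
  have hh: "h absolutely_integrable_on S \<longleftrightarrow> ?h absolutely_integrable_on S" "integral S h = integral S ?h"
    using h by (intro set_integrable_cong integral_cong; simp)+
  have h0: "0 \<le> h u" if "u \<in> S" for u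
    using h f0 that by simp
  show ?thesis
  proof (cases "f absolutely_integrable_on (g ` S)")
    case True
    then have "h absolutely_integrable_on S" "integral S h = integral (g ` S) f"
      using cov[of "integral (g ` S) f"] hh by auto
    then show ?thesis
      using nn_integral_eq_integral_lebesgue[of S h] h0 nn_integral_eq_integral_lebesgue[OF True f0] by simp
  next
    case False
    then have "\<not> h absolutely_integrable_on S"
      using cov hh by metis
    then show ?thesis
      using nn_integral_not_absolutely_integrable[OF _ h0 mh]
        nn_integral_not_absolutely_integrable[OF False f0 mf] by simp
  qed
qed

text \<open>A density in the sense of differential geometry: a positive continuous function in every
  chart that changes by the absolute value of the Jacobian determinant. The construction of the
  measure and the integration over \<open>M\<close> rest on these properties alone; the second
  fundamental form enters through an instance.\<close>

locale surface_density = C1_surface +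
  fixes \<rho> :: "'a chart \<Rightarrow> real^2 \<Rightarrow> real"
  assumes \<rho>_cont: "c \<in> A \<Longrightarrow> continuous_on (chart_range c) (\<rho> c)"
    and \<rho>_pos: "c \<in> A \<Longrightarrow> u \<in> chart_range c \<Longrightarrow> 0 < \<rho> c u"
    and \<rho>_change: "c \<in> A \<Longrightarrow> d \<in> A \<Longrightarrow> p \<in> fst c \<Longrightarrow> p \<in> fst d \<Longrightarrow>
      \<rho> c (snd c p) = \<bar>det (matrix (frechet_derivative (local_rep c (snd d)) (at (snd c p))))\<bar> * \<rho> d (snd d p)"
begin

abbreviation borel_M :: "'a measure" where "borel_M \<equiv> restrict_space borel M"

definition has_density :: "'a measure \<Rightarrow> bool" where
  "has_density \<mu> \<longleftrightarrow> sets \<mu> = sets borel_M \<and>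
    (\<forall>c\<in>A. \<forall>B\<in>sets \<mu>. B \<subseteq> fst c \<longrightarrow> emeasure \<mu> B = (\<integral>\<^sup>+u\<in>snd c ` B. ennreal (\<rho> c u) \<partial>lborel))"

definition chart_measure :: "'a chart \<Rightarrow> 'a measure" where
  "chart_measure c = distr (density (restrict_space lborel (chart_range c)) (\<lambda>u. ennreal (\<rho> c u)))
     borel_M (chart_inv c)"

lemma sets_openin:
  assumes "openin (top_of_set M) W"
  shows "W \<in> sets borel_M"
proof -
  obtain T where "open T" "W = M \<inter> T" using assms by (auto simp: openin_open)
  then show ?thesis unfolding sets_restrict_space by (intro image_eqI[of _ _ T]) auto
qed

lemma chart_in_sets: "c \<in> A \<Longrightarrow> fst c \<in> sets borel_M"
  by (intro sets_openin openin_chart)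

lemma measurable_chart_inv:
  assumes "c \<in> A"
  shows "chart_inv c \<in> measurable (restrict_space borel (chart_range c)) borel_M"
  using chart_subset[OF assms]
  by (intro measurable_restrict_space2 borel_measurable_continuous_on_restrict continuous_on_chart_inv assms)
    (auto simp: space_restrict_space)

text \<open>Written as a preimage under the continuous inverse of the chart, the image of a Borel
  set is seen to be Borel.\<close>

lemma chart_image_borel:
  assumes c: "c \<in> A" and B: "B \<in> sets borel_M" "B \<subseteq> fst c"
  shows "snd c ` B \<in> sets borel"
proof -
  have "snd c ` B = chart_inv c -` B \<inter> space (restrict_space borel (chart_range c))"
    using B(2) c by (force simp: space_restrict_space)
  also have "\<dots> \<in> sets (restrict_space borel (chart_range c))"
    by (rule measurable_sets[OF measurable_chart_inv[OF c] B(1)])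
  finally show ?thesis
    using open_chart_range[OF c] by (auto simp: sets_restrict_space)
qed

lemma measurable_\<rho>:
  assumes "c \<in> A"
  shows "\<rho> c \<in> borel_measurable (restrict_space borel (chart_range c))"
  by (intro borel_measurable_continuous_on_restrict \<rho>_cont assms)

lemma indicator_\<rho>_measurable:
  assumes c: "c \<in> A" and S: "S \<in> sets borel" "S \<subseteq> chart_range c"
  shows "(\<lambda>u. indicator S u *\<^sub>R \<rho> c u) \<in> borel_measurable borel"
proof -
  have "(\<lambda>u. indicator (chart_range c) u *\<^sub>R \<rho> c u) \<in> borel_measurable borel"
    using measurable_\<rho>[OF c] open_chart_range[OF c]
    by (subst (asm) borel_measurable_restrict_space_iff) auto
  then have "(\<lambda>u. indicator S u *\<^sub>R (indicator (chart_range c) u *\<^sub>R \<rho> c u)) \<in> borel_measurable borel"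
    using S(1) by measurable
  also have "(\<lambda>u. indicator S u *\<^sub>R (indicator (chart_range c) u *\<^sub>R \<rho> c u)) = (\<lambda>u. indicator S u *\<^sub>R \<rho> c u)"
    using S(2) by (auto simp: indicator_def fun_eq_iff)
  finally show ?thesis .
qed

lemma sets_chart_measure [simp]: "sets (chart_measure c) = sets borel_M"
  by (simp add: chart_measure_def)

lemma emeasure_chart_measure:
  assumes c: "c \<in> A" and B: "B \<in> sets borel_M"
  shows "emeasure (chart_measure c) B = (\<integral>\<^sup>+u\<in>snd c ` (fst c \<inter> B). ennreal (\<rho> c u) \<partial>lborel)"
proof -
  let ?R = "restrict_space lborel (chart_range c)"
  have m: "chart_inv c \<in> measurable ?R borel_M" "\<rho> c \<in> borel_measurable ?R"
    using measurable_chart_inv[OF c] measurable_\<rho>[OF c]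
    by (simp_all add: measurable_def sets_restrict_space space_restrict_space)
  have S: "chart_inv c -` B \<inter> space ?R \<in> sets ?R"
    by (rule measurable_sets[OF m(1) B])
  have eq: "chart_inv c -` B \<inter> space ?R = snd c ` (fst c \<inter> B)"
    using c by (force simp: space_restrict_space)
  have "emeasure (chart_measure c) B = emeasure (density ?R (\<lambda>u. ennreal (\<rho> c u))) (snd c ` (fst c \<inter> B))"
    unfolding chart_measure_def using m B eq by (subst emeasure_distr) auto
  also have "\<dots> = (\<integral>\<^sup>+u. ennreal (\<rho> c u) * indicator (snd c ` (fst c \<inter> B)) u \<partial>?R)"
    using m S by (intro emeasure_density) (auto simp: eq)
  also have "\<dots> = (\<integral>\<^sup>+u\<in>snd c ` (fst c \<inter> B). ennreal (\<rho> c u) \<partial>lborel)"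
    using open_chart_range[OF c]
    by (subst nn_integral_restrict_space) (auto intro!: nn_integral_cong simp: indicator_def)
  finally show ?thesis .
qed

text \<open>The transformation law relates \<open>\<rho> c\<close> and \<open>\<rho> d\<close> along
  the transition map, so the substitution rule identifies the two measures on the overlap. This
  compatibility lets them be glued.\<close>

lemma chart_measure_overlap:
  assumes c: "c \<in> A" and d: "d \<in> A" and B: "B \<in> sets borel_M" "B \<subseteq> fst c" "B \<subseteq> fst d"
  shows "emeasure (chart_measure c) B = emeasure (chart_measure d) B"
proof -
  let ?\<tau> = "local_rep c (snd d)"
  have \<tau>: "?\<tau> (snd c p) = snd d p" if "p \<in> B" for p
    using c B(2) that by auto
  have im: "?\<tau> ` snd c ` B = snd d ` B"
    using \<tau> by (force simp: image_image)
  have "(\<integral>\<^sup>+v\<in>?\<tau> ` snd c ` B. ennreal (\<rho> d v) \<partial>lborel) = (\<integral>\<^sup>+u\<in>snd c ` B. ennreal (\<rho> c u) \<partial>lborel)"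
  proof (rule nn_integral_change_of_variables[where g' = "\<lambda>u. frechet_derivative ?\<tau> (at u)"])
    show "snd c ` B \<in> sets borel" by (rule chart_image_borel[OF c B(1,2)])
    show "(?\<tau> has_derivative frechet_derivative ?\<tau> (at u)) (at u within snd c ` B)" if "u \<in> snd c ` B" for u
    proof -
      have "u \<in> snd c ` (fst c \<inter> fst d)" using that B by blast
      then have "?\<tau> differentiable (at u)"
        by (rule C1_differentiable[OF C1_transition[OF c d]])
      then show ?thesis
        by (simp add: frechet_derivative_works has_derivative_at_withinI)
    qed
    show "inj_on ?\<tau> (snd c ` B)"
      using inj_on_chart[OF d] B(3) \<tau> by (auto simp: inj_on_def)
    show "\<rho> c u = \<bar>det (matrix (frechet_derivative ?\<tau> (at u)))\<bar> * \<rho> d (?\<tau> u)" if u: "u \<in> snd c ` B" for u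
    proof -
      obtain p where p: "p \<in> B" "u = snd c p" using u by blast
      then show ?thesis using \<rho>_change[OF c d, of p] B(2,3) \<tau>[of p] by auto
    qed
    show "0 \<le> \<rho> d v" if "v \<in> ?\<tau> ` snd c ` B" for v
      using that unfolding im using \<rho>_pos[OF d] B(3) by (force intro: less_imp_le)
    show "(\<lambda>v. indicator (?\<tau> ` snd c ` B) v *\<^sub>R \<rho> d v) \<in> borel_measurable borel"
      unfolding im using B(3) by (intro indicator_\<rho>_measurable d chart_image_borel B) auto
    show "(\<lambda>u. indicator (snd c ` B) u *\<^sub>R \<rho> c u) \<in> borel_measurable borel"
      using B(2) by (intro indicator_\<rho>_measurable c chart_image_borel B) auto
  qed
  then show ?thesis
    using B c d by (simp add: emeasure_chart_measure im inf.absorb2)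
qed

lemma finite_chart_cover:
  obtains n :: nat and f :: "nat \<Rightarrow> 'a chart" where "\<forall>i<n. f i \<in> A" "(\<Union>i<n. fst (f i)) = M"
proof -
  have "\<exists>D\<subseteq>fst ` A. finite D \<and> M \<subseteq> \<Union>D"
    using openin_chart charts_cover by (intro compact_M[unfolded compact_eq_openin_cover, rule_format]) auto
  then obtain D where D: "D \<subseteq> fst ` A" "finite D" "M \<subseteq> \<Union>D" by blast
  obtain C where C: "C \<subseteq> A" "finite C" "M \<subseteq> (\<Union>c\<in>C. fst c)"
    using finite_subset_image[OF D(2,1)] D(3) by blast
  obtain f :: "nat \<Rightarrow> 'a chart" and n where f: "C = f ` {i. i < n}"
    using finite_imp_nat_seg_image_inj_on[OF C(2)] by blast
  show thesis
  proof (rule that[of n f])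
    show "\<forall>i<n. f i \<in> A" using f C(1) by auto
    show "(\<Union>i<n. fst (f i)) = M"
    proof
      show "(\<Union>i<n. fst (f i)) \<subseteq> M" using C(1) f chart_subset by blast
      show "M \<subseteq> (\<Union>i<n. fst (f i))" using C(3) f by auto
    qed
  qed
qed

text \<open>Compactness gives finitely many charts; removing the earlier domains from each makes the
  pieces disjoint. Statements about measures on \<open>M\<close> thereby reduce to Borel sets inside
  one chart.\<close>

lemma finite_borel_partition:
  obtains n :: nat and f :: "nat \<Rightarrow> 'a chart" and D :: "nat \<Rightarrow> 'a set"
  where "\<forall>i<n. f i \<in> A" "\<forall>i<n. D i \<in> sets borel_M" "\<forall>i<n. D i \<subseteq> fst (f i)"
    "disjoint_family_on D {..<n}" "(\<Union>i<n. D i) = M"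
proof -
  obtain n :: nat and f :: "nat \<Rightarrow> 'a chart" where f: "\<forall>i<n. f i \<in> A" "(\<Union>i<n. fst (f i)) = M"
    using finite_chart_cover .
  let ?D = "disjointed (\<lambda>i. fst (f i))"
  show thesis
  proof (rule that[of n f ?D])
    show "\<forall>i<n. ?D i \<in> sets borel_M"
      unfolding disjointed_def using f(1) chart_in_sets by (intro allI impI sets.Diff sets.finite_UN) auto
    show "\<forall>i<n. ?D i \<subseteq> fst (f i)" by (auto intro: subsetD[OF disjointed_subset])
    show "disjoint_family_on ?D {..<n}"
      by (rule disjoint_family_on_mono[OF subset_UNIV disjoint_family_disjointed])
    show "(\<Union>i<n. ?D i) = M"
      using f(2) finite_UN_disjointed_eq[of "\<lambda>i. fst (f i)" n] by (simp add: atLeast0LessThan)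
  qed (use f in auto)
qed

text \<open>Each Borel set splits into finitely many pieces contained in single charts, where the
  density prescribes the value.\<close>

lemma has_density_unique:
  assumes "has_density \<mu>" "has_density \<mu>'"
  shows "\<mu> = \<mu>'"
proof (rule measure_eqI)
  have s: "sets \<mu> = sets borel_M" "sets \<mu>' = sets borel_M"
    using assms by (auto simp: has_density_def)
  then show "sets \<mu> = sets \<mu>'" by simp
  fix B assume B: "B \<in> sets \<mu>"
  then have BM: "B \<subseteq> M" using sets.sets_into_space[of B borel_M] s by (auto simp: space_restrict_space)
  obtain n :: nat and f :: "nat \<Rightarrow> 'a chart" and D :: "nat \<Rightarrow> 'a set" where f: "\<forall>i<n. f i \<in> A" and D: "\<forall>i<n. D i \<in> sets borel_M"
    "\<forall>i<n. D i \<subseteq> fst (f i)" "disjoint_family_on D {..<n}" "(\<Union>i<n. D i) = M"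
    using finite_borel_partition .
  have "emeasure \<mu> B = (\<Sum>i<n. emeasure \<mu> (B \<inter> D i))"
    using B D BM s by (intro sum_emeasure_cover) auto
  also have "\<dots> = (\<Sum>i<n. emeasure \<mu>' (B \<inter> D i))"
  proof (rule sum.cong[OF refl])
    fix i assume "i \<in> {..<n}"
    then have "f i \<in> A" "B \<inter> D i \<in> sets borel_M" "B \<inter> D i \<subseteq> fst (f i)"
      using f D B s by auto
    then show "emeasure \<mu> (B \<inter> D i) = emeasure \<mu>' (B \<inter> D i)"
      using assms s by (auto simp: has_density_def)
  qed
  also have "\<dots> = emeasure \<mu>' B"
    using B D BM s by (intro sum_emeasure_cover[symmetric]) auto
  finally show "emeasure \<mu> B = emeasure \<mu>' B" .
qed

text \<open>The chart measures are added up over the pieces of a Borel partition. Agreement on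
  overlaps gives the sum the right density in every chart of the atlas, not only in those chosen for
  the partition.\<close>

lemma has_density_exists: "\<exists>\<mu>. has_density \<mu>"
proof -
  obtain n :: nat and f :: "nat \<Rightarrow> 'a chart" and D :: "nat \<Rightarrow> 'a set" where f: "\<forall>i<n. f i \<in> A" and D: "\<forall>i<n. D i \<in> sets borel_M"
    "\<forall>i<n. D i \<subseteq> fst (f i)" "disjoint_family_on D {..<n}" "(\<Union>i<n. D i) = M"
    using finite_borel_partition .
  define m where "m B = (\<Sum>i<n. emeasure (chart_measure (f i)) (B \<inter> D i))" for B
  define \<mu> where "\<mu> = measure_of M (sets borel_M) m"
  have pow: "sets borel_M \<subseteq> Pow M"
    using sets.sets_into_space[of _ borel_M] by (auto simp: space_restrict_space)
  have s: "sets \<mu> = sets borel_M"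
    using sets.sigma_sets_eq[of borel_M] by (simp add: \<mu>_def sets_measure_of[OF pow] space_restrict_space)
  have em: "emeasure \<mu> B = m B" if "B \<in> sets borel_M" for B
  proof (rule emeasure_measure_of[OF \<mu>_def pow])
    show "positive (sets \<mu>) m" by (simp add: positive_def m_def)
    show "countably_additive (sets \<mu>) m"
      unfolding countably_additive_def s
    proof (intro allI impI)
      fix F :: "nat \<Rightarrow> 'a set"
      assume F: "range F \<subseteq> sets borel_M" "disjoint_family F"
      have "(\<Sum>j. m (F j)) = (\<Sum>i<n. \<Sum>j. emeasure (chart_measure (f i)) (F j \<inter> D i))"
        unfolding m_def by (intro suminf_sum) auto
      also have "\<dots> = (\<Sum>i<n. emeasure (chart_measure (f i)) (\<Union>j. F j \<inter> D i))"
      proof (intro sum.cong refl suminf_emeasure)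
        fix i assume "i \<in> {..<n}"
        then show "range (\<lambda>j. F j \<inter> D i) \<subseteq> sets (chart_measure (f i))"
          using F(1) D(1) by auto
        show "disjoint_family (\<lambda>j. F j \<inter> D i)"
          using F(2) by (auto simp: disjoint_family_on_def)
      qed
      finally show "(\<Sum>j. m (F j)) = m (\<Union>(range F))" by (simp add: m_def)
    qed
    show "B \<in> sets \<mu>" using that s by simp
  qed
  have "emeasure \<mu> B = (\<integral>\<^sup>+u\<in>snd d ` B. ennreal (\<rho> d u) \<partial>lborel)"
    if d: "d \<in> A" and B: "B \<in> sets borel_M" "B \<subseteq> fst d" for B d
  proof -
    have BM: "B \<subseteq> M" using B pow by auto
    have "emeasure \<mu> B = (\<Sum>i<n. emeasure (chart_measure (f i)) (B \<inter> D i))"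
      using em[OF B(1)] by (simp add: m_def)
    \<comment> \<open>\<open>B \<inter> D i\<close> lies both in the chart \<open>f i\<close> and in
      \<open>d\<close>, so its measure may be computed in \<open>d\<close>.\<close>
    also have "\<dots> = (\<Sum>i<n. emeasure (chart_measure d) (B \<inter> D i))"
      using f D B d by (intro sum.cong refl chart_measure_overlap) auto
    also have "\<dots> = emeasure (chart_measure d) B"
      using B D BM by (intro sum_emeasure_cover[symmetric]) auto
    also have "\<dots> = (\<integral>\<^sup>+u\<in>snd d ` B. ennreal (\<rho> d u) \<partial>lborel)"
      using B by (simp add: emeasure_chart_measure[OF d] inf.absorb2)
    finally show ?thesis .
  qed
  then show ?thesis using s by (auto simp: has_density_def)
qed

lemma has_density_The: "has_density (THE \<mu>. has_density \<mu>)"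
  using has_density_exists has_density_unique by (metis theI)

section \<open>Integration against the glued measure\<close>

context
  fixes \<mu> assumes \<mu>: "has_density \<mu>"
begin

lemma sets_density_measure: "sets \<mu> = sets borel_M"
  using \<mu> by (simp add: has_density_def)

lemma density_indicator_chart:
  assumes c: "c \<in> A"
  shows "density \<mu> (indicator (fst c)) = chart_measure c"
proof (rule measure_eqI)
  show "sets (density \<mu> (indicator (fst c))) = sets (chart_measure c)"
    by (simp add: sets_density_measure)
  fix B assume "B \<in> sets (density \<mu> (indicator (fst c)))"
  then have B: "B \<in> sets \<mu>" by simp
  have U: "fst c \<in> sets \<mu>" using chart_in_sets[OF c] sets_density_measure by simp
  have "emeasure (density \<mu> (indicator (fst c))) B = (\<integral>\<^sup>+p. indicator (fst c) p * indicator B p \<partial>\<mu>)"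
    using B U by (intro emeasure_density) auto
  also have "\<dots> = (\<integral>\<^sup>+p. indicator (fst c \<inter> B) p \<partial>\<mu>)"
    by (simp add: indicator_inter_arith)
  also have "\<dots> = emeasure \<mu> (fst c \<inter> B)"
    using B U by simp
  also have "\<dots> = (\<integral>\<^sup>+u\<in>snd c ` (fst c \<inter> B). ennreal (\<rho> c u) \<partial>lborel)"
    using \<mu> c B U by (simp add: has_density_def)
  also have "\<dots> = emeasure (chart_measure c) B"
    using B c sets_density_measure by (simp add: emeasure_chart_measure)
  finally show "emeasure (density \<mu> (indicator (fst c))) B = emeasure (chart_measure c) B" .
qed

lemma measurable_chart_support:
  fixes g :: "'a \<Rightarrow> real"
  assumes c: "c \<in> A" and g: "continuous_on (chart_range c) (local_rep c g)"
    and g0: "\<And>p. p \<in> M - fst c \<Longrightarrow> g p = 0"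
  shows "g \<in> borel_measurable \<mu>"
proof -
  have "continuous_on (fst c) (\<lambda>p. local_rep c g (snd c p))"
    using continuous_on_compose[OF continuous_on_chart[OF c] g] by (simp add: o_def)
  then have "continuous_on (fst c) g"
    by (rule continuous_on_cong[OF refl, THEN iffD1, rotated]) (use c in simp)
  then have "g \<in> borel_measurable (restrict_space borel (fst c))"
    by (rule borel_measurable_continuous_on_restrict)
  moreover have "sets (restrict_space \<mu> (fst c)) = sets (restrict_space borel (fst c))"
  proof -
    have "sets (restrict_space \<mu> (fst c)) = sets (restrict_space borel_M (fst c))"
      by (intro sets_restrict_space_cong sets_density_measure)
    then show ?thesis
      using chart_subset[OF c] by (simp add: sets_restrict_restrict_space inf.absorb2)
  qed
  ultimately have "g \<in> borel_measurable (restrict_space \<mu> (fst c))"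
    by (simp cong: measurable_cong_sets)
  then have "(\<lambda>p. indicator (fst c) p *\<^sub>R g p) \<in> borel_measurable \<mu>"
    using chart_in_sets[OF c] sets_density_measure
    by (subst (asm) borel_measurable_restrict_space_iff) auto
  moreover have "indicator (fst c) p *\<^sub>R g p = g p" if "p \<in> space \<mu>" for p
    using that g0[of p] sets_eq_imp_space_eq[OF sets_density_measure]
    by (auto simp: space_restrict_space indicator_def)
  ultimately show ?thesis by (rule measurable_cong[THEN iffD1, rotated])
qed

text \<open>On the open chart range the continuous functions \<open>local_rep c g\<close> and
  \<open>\<rho> c\<close> may be unbounded; integrability comes from \<open>g\<close> vanishing off
  the compact \<open>K\<close>. The integral is then taken against the chart measure, a push-forward
  of weighted Lebesgue measure.\<close>

lemma integral_chart_support: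
  fixes g :: "'a \<Rightarrow> real"
  assumes c: "c \<in> A" and K: "compact K" "K \<subseteq> fst c"
    and g: "continuous_on (chart_range c) (local_rep c g)"
    and g0: "\<And>p. p \<in> M - K \<Longrightarrow> g p = 0"
  shows "integrable \<mu> g"
    "integral\<^sup>L \<mu> g = (LINT u|lborel. indicator (chart_range c) u * (local_rep c g u * \<rho> c u))"
proof -
  let ?R = "restrict_space lborel (chart_range c)"
  let ?h = "\<lambda>u. indicator (chart_range c) u * (local_rep c g u * \<rho> c u)"
  have gm: "g \<in> borel_measurable \<mu>"
    using K(2) by (intro measurable_chart_support[OF c g] g0) auto
  have sp: "space \<mu> = M"
    using sets_eq_imp_space_eq[OF sets_density_measure] by (simp add: space_restrict_space)
  have U: "fst c \<in> sets \<mu>" using chart_in_sets[OF c] sets_density_measure by simp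
  have ind: "(\<lambda>p. indicator (fst c) p *\<^sub>R g p) p = g p" if "p \<in> space \<mu>" for p
    using that g0[of p] K(2) sp by (auto simp: indicator_def)
  have m: "chart_inv c \<in> measurable ?R borel_M" "\<rho> c \<in> borel_measurable ?R"
    using measurable_chart_inv[OF c] measurable_\<rho>[OF c]
    by (simp_all add: measurable_def sets_restrict_space space_restrict_space)
  have gB: "g \<in> borel_measurable borel_M"
    using gm sets_density_measure by (simp cong: measurable_cong_sets)
  have lm: "(\<lambda>u. g (chart_inv c u)) \<in> borel_measurable ?R"
    using measurable_compose[OF m(1) gB] .
  have \<rho>0: "AE u in ?R. 0 \<le> \<rho> c u"
    using \<rho>_pos[OF c] by (intro AE_I2) (auto simp: space_restrict_space intro: less_imp_le)
  have R: "chart_range c \<inter> space lborel \<in> sets lborel"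
    using open_chart_range[OF c] by simp
  have dens: "density \<mu> (\<lambda>p. ennreal (indicator (fst c) p)) = chart_measure c"
    using density_indicator_chart[OF c] by (simp add: ennreal_indicator)
  have h_int: "integrable lborel ?h"
  proof -
    have KK: "compact (snd c ` K)"
      by (rule compact_continuous_image[OF continuous_on_subset[OF continuous_on_chart[OF c] K(2)] K(1)])
    have "continuous_on (snd c ` K) (\<lambda>u. local_rep c g u * \<rho> c u)"
      using K(2) by (intro continuous_intros continuous_on_subset[OF g] continuous_on_subset[OF \<rho>_cont[OF c]]) auto
    then have "integrable lborel (\<lambda>u. indicator (snd c ` K) u *\<^sub>R (local_rep c g u * \<rho> c u))"
      by (rule borel_integrable_compact[OF KK])
    also have "(\<lambda>u. indicator (snd c ` K) u *\<^sub>R (local_rep c g u * \<rho> c u)) = ?h"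
    proof
      fix u
      show "indicator (snd c ` K) u *\<^sub>R (local_rep c g u * \<rho> c u) = ?h u"
      proof (cases "u \<in> chart_range c")
        case True
        then obtain p where p: "p \<in> fst c" "u = snd c p" by blast
        show ?thesis
        proof (cases "p \<in> K")
          case True
          then show ?thesis using p by simp
        next
          case False
          then have "local_rep c g u = 0"
            using p c g0[of p] chart_subset[OF c] by auto
          then show ?thesis by simp
        qed
      next
        case False
        then have "u \<notin> snd c ` K" using K(2) by blast
        then show ?thesis using False by simp
      qed
    qed
    finally show ?thesis .
  qed
  have eq: "(\<lambda>u. indicator (chart_range c) u *\<^sub>R (\<rho> c u *\<^sub>R g (chart_inv c u))) = ?h"
    by (simp add: local_rep_apply mult_ac)
  have "integrable (chart_measure c) g"
    unfolding chart_measure_def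
  proof (subst integrable_distr_eq)
    show "integrable (density ?R (\<lambda>u. ennreal (\<rho> c u))) (\<lambda>u. g (chart_inv c u))"
      using h_int by (subst integrable_density[OF lm m(2) \<rho>0], subst integrable_restrict_space[OF R]) (simp only: eq)
  qed (use m gB in simp_all)
  then have "integrable \<mu> (\<lambda>p. indicator (fst c) p *\<^sub>R g p)"
    unfolding dens[symmetric] using U gm by (subst (asm) integrable_density) auto
  then show "integrable \<mu> g"
    by (rule Bochner_Integration.integrable_cong[THEN iffD1, rotated -1]) (use ind in auto)
  have "integral\<^sup>L \<mu> g = integral\<^sup>L \<mu> (\<lambda>p. indicator (fst c) p *\<^sub>R g p)"
    using ind by (intro Bochner_Integration.integral_cong) auto
  also have "\<dots> = integral\<^sup>L (chart_measure c) g"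
    unfolding dens[symmetric] using U gm by (subst integral_density) auto
  also have "\<dots> = integral\<^sup>L (density ?R (\<lambda>u. ennreal (\<rho> c u))) (\<lambda>u. g (chart_inv c u))"
    unfolding chart_measure_def using m gB by (subst integral_distr) simp_all
  also have "\<dots> = integral\<^sup>L lborel ?h"
    by (subst integral_density[OF lm m(2) \<rho>0], subst integral_restrict_space[OF R]) (simp only: eq)
  finally show "integral\<^sup>L \<mu> g = integral\<^sup>L lborel ?h" .
qed

text \<open>A vanishing integral gives \<open>g = 0\<close> almost everywhere only. If
  \<open>g p > 0\<close>, continuity makes \<open>g\<close> positive on the preimage of an open part
  of the chart range, and this has positive measure because \<open>\<rho>\<close> is positive and a
  ball has positive Lebesgue measure.\<close>

lemma integral_nonneg_eq_0_imp:
  fixes g :: "'a \<Rightarrow> real"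
  assumes g: "\<And>c. c \<in> A \<Longrightarrow> continuous_on (chart_range c) (local_rep c g)"
    and nonneg: "\<And>p. p \<in> M \<Longrightarrow> 0 \<le> g p"
    and int: "integrable \<mu> g" "integral\<^sup>L \<mu> g = 0" and p: "p \<in> M"
  shows "g p = 0"
proof (rule ccontr)
  assume "g p \<noteq> 0"
  then have gp: "g p > 0" using nonneg[OF p] by simp
  obtain c where c: "c \<in> A" "p \<in> fst c" using p charts_cover by blast
  have sp: "space \<mu> = M"
    using sets_eq_imp_space_eq[OF sets_density_measure] by (simp add: space_restrict_space)
  define V where "V = chart_range c \<inter> local_rep c g -` {0<..}"
  have oV: "open V"
    unfolding V_def using open_chart_range[OF c(1)] g[OF c(1)] by (intro continuous_open_preimage) auto
  have pV: "snd c p \<in> V" using c gp by (simp add: V_def)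
  define B where "B = fst c \<inter> snd c -` V"
  have B: "B \<in> sets borel_M" unfolding B_def by (intro sets_openin openin_chart_preimage c oV)
  have im: "snd c ` B = V" unfolding B_def V_def by auto
  have "AE q in \<mu>. 0 \<le> g q" using nonneg sp by (intro AE_I2) simp
  then have "AE q in \<mu>. g q = 0"
    using integral_nonneg_eq_0_iff_AE[OF int(1)] int(2) nonneg sp by simp
  moreover have "g q \<noteq> 0" if "q \<in> B" for q
  proof -
    have "snd c q \<in> V" "q \<in> fst c" using that by (auto simp: B_def)
    then have "local_rep c g (snd c q) > 0" unfolding V_def by blast
    then show ?thesis using c(1) \<open>q \<in> fst c\<close> by simp
  qed
  ultimately have "AE q in \<mu>. q \<notin> B" by (auto elim: eventually_mono)
  moreover have "B \<in> sets \<mu>" using B sets_density_measure by simp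
  ultimately have "emeasure \<mu> B = 0"
    by (subst (asm) AE_iff_measurable[where N = B]) (use sp B chart_subset[OF c(1)] in \<open>auto simp: B_def\<close>)
  then have "(\<integral>\<^sup>+u\<in>V. ennreal (\<rho> c u) \<partial>lborel) = 0"
    using \<mu> c(1) B im sets_density_measure by (auto simp: has_density_def B_def)
  moreover have "(\<lambda>u. ennreal (\<rho> c u) * indicator V u) \<in> borel_measurable lborel"
  proof -
    have "(\<lambda>u. ennreal (indicator V u *\<^sub>R \<rho> c u)) \<in> borel_measurable borel"
      using indicator_\<rho>_measurable[OF c(1), of V] oV by (auto simp: V_def)
    also have "(\<lambda>u. ennreal (indicator V u *\<^sub>R \<rho> c u)) = (\<lambda>u. ennreal (\<rho> c u) * indicator V u)"
      by (auto simp: indicator_def)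
    finally show ?thesis by simp
  qed
  ultimately have "AE u in lborel. ennreal (\<rho> c u) * indicator V u = 0"
    by (simp add: nn_integral_0_iff_AE)
  moreover have "ennreal (\<rho> c u) * indicator V u \<noteq> 0" if "u \<in> V" for u
  proof -
    have "u \<in> chart_range c" using that unfolding V_def by blast
    from \<rho>_pos[OF c(1) this] show ?thesis using that by (simp add: ennreal_eq_0_iff not_le)
  qed
  ultimately have "AE u in lborel. u \<notin> V"
    by (auto elim: eventually_mono)
  then have "emeasure lborel V = 0"
    using oV by (subst (asm) AE_iff_measurable[where N = V]) auto
  moreover have "emeasure lborel V \<noteq> 0"
  proof -
    obtain e where e: "e > 0" "ball (snd c p) e \<subseteq> V"
      using oV pV open_contains_ball by blast
    have "0 < measure lborel (ball (snd c p) e)"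
      using e(1) by (rule content_ball_pos)
    then have "emeasure lborel (ball (snd c p) e) \<noteq> 0" by (auto simp: measure_def)
    moreover have "emeasure lborel (ball (snd c p) e) \<le> emeasure lborel V"
      using e(2) oV by (intro emeasure_mono) auto
    ultimately show ?thesis by auto
  qed
  ultimately show False by simp
qed

end

end

subsection \<open>Vector algebra in a tangent plane\<close>

lemma cross3_nonzero:
  fixes a b :: "real^3"
  assumes "\<And>\<alpha> \<beta>. \<alpha> *\<^sub>R a + \<beta> *\<^sub>R b = 0 \<Longrightarrow> \<alpha> = 0 \<and> \<beta> = 0"
  shows "cross3 a b \<noteq> 0"
proof
  assume "cross3 a b = 0"
  \<comment> \<open>The double product is a linear combination of \<open>a\<close> and
    \<open>b\<close>; if it vanishes, independence forces \<open>b \<bullet> b = 0\<close>.\<close>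
  moreover have "cross3 b (cross3 a b) = (b \<bullet> b) *\<^sub>R a + (- (a \<bullet> b)) *\<^sub>R b"
    by (simp add: cross3_simps forall_3)
  ultimately have "(b \<bullet> b) *\<^sub>R a + (- (a \<bullet> b)) *\<^sub>R b = 0" by simp
  then have "b = 0" using assms by fastforce
  then show False using assms[of 0 1] by simp
qed

lemma cross3_eq_normal:
  fixes a b \<xi> :: "real^3"
  assumes "norm \<xi> = 1" "\<xi> \<bullet> a = 0" "\<xi> \<bullet> b = 0"
  shows "cross3 a b = (cross3 a b \<bullet> \<xi>) *\<^sub>R \<xi>"
proof -
  have "cross3 \<xi> (cross3 a b) = (\<xi> \<bullet> b) *\<^sub>R a - (\<xi> \<bullet> a) *\<^sub>R b"
    by (simp add: cross3_simps forall_3)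
  then have 0: "cross3 \<xi> (cross3 a b) = 0" using assms by simp
  have "cross3 \<xi> (cross3 \<xi> n) = (n \<bullet> \<xi>) *\<^sub>R \<xi> - (\<xi> \<bullet> \<xi>) *\<^sub>R n" for n :: "real^3"
    by (simp add: cross3_simps forall_3)
  from this[of "cross3 a b"] 0 assms(1) show ?thesis
    by (simp add: dot_square_norm)
qed

text \<open>For tangent \<open>a\<close> and \<open>b\<close> the cross product is normal, so its
  product with \<open>v\<close> sees only the normal component of \<open>v\<close>. This is how
  support functions come out of determinants.\<close>

lemma cross3_dot_eq:
  fixes a b \<xi> v :: "real^3"
  assumes "norm \<xi> = 1" "\<xi> \<bullet> a = 0" "\<xi> \<bullet> b = 0"
  shows "cross3 a b \<bullet> v = (cross3 a b \<bullet> \<xi>) * (\<xi> \<bullet> v)"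
  by (subst cross3_eq_normal[OF assms]) simp

text \<open>Cramer's rule, with all determinants written as triple products.\<close>

lemma cross3_Cramer:
  fixes a b \<xi> v :: "real^3"
  shows "(cross3 a b \<bullet> \<xi>) *\<^sub>R v = (cross3 v b \<bullet> \<xi>) *\<^sub>R a + (cross3 a v \<bullet> \<xi>) *\<^sub>R b + (cross3 a b \<bullet> v) *\<^sub>R \<xi>"
  by (simp add: cross3_simps forall_3)

text \<open>The polarization of \<open>cross3_self_change_basis\<close>: the sum is the symmetric
  bilinear form belonging to the quadratic map that sends a pair to its cross product. It serves for
  \<open>shape_vol\<close>, where one factor comes from the immersion and the other from the
  normalization.\<close>

lemma cross3_change_basis:
  fixes a1 a2 b1 b2 :: "real^3"
  shows "cross3 (p *\<^sub>R a1 + q *\<^sub>R a2) (r *\<^sub>R b1 + s *\<^sub>R b2) + cross3 (p *\<^sub>R b1 + q *\<^sub>R b2) (r *\<^sub>R a1 + s *\<^sub>R a2)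
    = (p * s - q * r) *\<^sub>R (cross3 a1 b2 + cross3 b1 a2)"
  by (simp add: cross3_simps forall_3)

lemma cross3_self_change_basis:
  fixes a1 a2 :: "real^3"
  shows "cross3 (p *\<^sub>R a1 + q *\<^sub>R a2) (r *\<^sub>R a1 + s *\<^sub>R a2) = (p * s - q * r) *\<^sub>R cross3 a1 a2"
  by (simp add: cross3_simps forall_3)

text \<open>The Binet-Cauchy identity; it expresses the determinants of both fundamental forms
  through cross products.\<close>

lemma cross3_dot_cross3:
  fixes a b c d :: "real^3"
  shows "cross3 a b \<bullet> cross3 c d = (a \<bullet> c) * (b \<bullet> d) - (a \<bullet> d) * (b \<bullet> c)"
  by (simp add: cross3_simps)

text \<open>A nowhere vanishing continuous function has locally constant sign. A chart range need
  not be connected, so the sign is kept as a function with vanishing derivatives.\<close>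

lemma C1_sgn:
  fixes \<nu> :: "real^'n::finite \<Rightarrow> real"
  assumes "continuous_on S \<nu>" "open S" "\<And>u. u \<in> S \<Longrightarrow> \<nu> u \<noteq> 0"
  shows "Ck_on 1 (\<lambda>u. sgn (\<nu> u)) S" "u \<in> S \<Longrightarrow> partial i (\<lambda>u. sgn (\<nu> u)) u = 0"
proof -
  let ?P = "S \<inter> \<nu> -` {0<..}" and ?N = "S \<inter> \<nu> -` {..<0}"
  have o: "open ?P" "open ?N"
    using assms(1,2) by (auto intro: continuous_open_preimage)
  have S: "S = ?P \<union> ?N" using assms(3) by force
  have "Ck_on 1 (\<lambda>u. sgn (\<nu> u)) ?P" "Ck_on 1 (\<lambda>u. sgn (\<nu> u)) ?N"
    by (rule C1_transform_open[OF C1_const[of 1] o(1)], simp)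
      (rule C1_transform_open[OF C1_const[of "-1"] o(2)], simp)
  from C1_Un_open[OF this o] S show "Ck_on 1 (\<lambda>u. sgn (\<nu> u)) S" by simp
  assume u: "u \<in> S"
  show "partial i (\<lambda>u. sgn (\<nu> u)) u = 0"
  proof (cases "\<nu> u > 0")
    case True
    then have "u \<in> ?P" using u by simp
    then have "partial i (\<lambda>u. sgn (\<nu> u)) u = partial i (\<lambda>_. 1) u"
      by (rule partial_cong_open[OF o(1)]) simp
    then show ?thesis by (simp add: partial_eq[OF has_derivative_const])
  next
    case False
    then have "u \<in> ?N" using u assms(3)[of u] by simp
    then have "partial i (\<lambda>u. sgn (\<nu> u)) u = partial i (\<lambda>_. -1) u"
      by (rule partial_cong_open[OF o(2)]) simp
    then show ?thesis by (simp add: partial_eq[OF has_derivative_const])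
  qed
qed

subsection \<open>Pairs of relative normalizations\<close>

text \<open>\<open>z\<close> is the equiaffine normalization, identified by \<open>z_aff\<close>.
  The differentiability classes are those of the computation: \<open>x\<close> of class C^2 makes
  the tangent vectors and the normal C^1, and \<open>y\<close> and \<open>z\<close> are
  differentiated once.\<close>

locale relative_pair = C1_surface M A for M :: "'a::t2_space set" and A +
  fixes x \<xi> y z :: "'a \<Rightarrow> real^3"
  assumes x_C2: "\<And>c. c \<in> A \<Longrightarrow> Ck_on 2 (local_rep c x) (chart_range c)"
    and normal: "unit_normal_field M A x \<xi>"
    and y_rel: "relative_normalization 1 A x y"
    and z_rel: "relative_normalization 1 A x z"
    and y_pos: "\<And>p. p \<in> M \<Longrightarrow> 0 < support_fun \<xi> y p"
    and II_pos: "positive_definite_II A x \<xi>"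
    and K_pos: "\<And>p. p \<in> M \<Longrightarrow> 0 < gauss_curvature A x \<xi> p"
    and z_aff: "\<And>p. p \<in> M \<Longrightarrow> support_fun \<xi> z p = \<bar>gauss_curvature A x \<xi> p\<bar> powr (1/4)"
begin

abbreviation D :: "2 \<Rightarrow> 'a chart \<Rightarrow> ('a \<Rightarrow> 'b::real_normed_vector) \<Rightarrow> real^2 \<Rightarrow> 'b" where
  "D i c f \<equiv> partial i (local_rep c f)"

definition vol :: "'a chart \<Rightarrow> real^2 \<Rightarrow> real" where
  "vol c u = cross3 (D 1 c x u) (D 2 c x u) \<bullet> local_rep c \<xi> u"

text \<open>For a relative normalization f with mean curvature H this is -2 H times
  \<open>vol\<close>, by the defining equation of the shape operator. It makes H accessible to
  differential calculus without solving for the matrix.\<close>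

definition shape_vol :: "'a chart \<Rightarrow> ('a \<Rightarrow> real^3) \<Rightarrow> real^2 \<Rightarrow> real" where
  "shape_vol c f u = (cross3 (D 1 c f u) (D 2 c x u) + cross3 (D 1 c x u) (D 2 c f u)) \<bullet> local_rep c \<xi> u"

lemma in_M: "c \<in> A \<Longrightarrow> u \<in> chart_range c \<Longrightarrow> chart_inv c u \<in> M"
  using chart_inv_in[of u c] chart_subset[of c] by blast

lemma norm_\<xi>: "c \<in> A \<Longrightarrow> u \<in> chart_range c \<Longrightarrow> norm (local_rep c \<xi> u) = 1"
  using normal in_M by (simp add: unit_normal_field_def local_rep_apply)

lemma \<xi>_Dx: "c \<in> A \<Longrightarrow> u \<in> chart_range c \<Longrightarrow> local_rep c \<xi> u \<bullet> D i c x u = 0"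
  using normal by (auto simp: unit_normal_field_def)

lemma z_pos: "p \<in> M \<Longrightarrow> 0 < support_fun \<xi> z p"
  using z_aff[of p] K_pos[of p] by simp

lemma independent_Dx:
  assumes "c \<in> A" "u \<in> chart_range c" "\<alpha> *\<^sub>R D 1 c x u + \<beta> *\<^sub>R D 2 c x u = 0"
  shows "\<alpha> = 0 \<and> \<beta> = 0"
proof -
  have "\<alpha> *\<^sub>R D 1 c x u + \<beta> *\<^sub>R D 2 c x u + 0 *\<^sub>R local_rep c y u = 0" using assms(3) by simp
  then show ?thesis using y_rel assms(1,2) unfolding relative_normalization_def by blast
qed

lemma cross_Dx: "c \<in> A \<Longrightarrow> u \<in> chart_range c \<Longrightarrow>
    cross3 (D 1 c x u) (D 2 c x u) = vol c u *\<^sub>R local_rep c \<xi> u"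
  unfolding vol_def by (intro cross3_eq_normal norm_\<xi> \<xi>_Dx)

lemma vol_nonzero:
  assumes "c \<in> A" "u \<in> chart_range c"
  shows "vol c u \<noteq> 0"
  using cross3_nonzero[of "D 1 c x u" "D 2 c x u"] independent_Dx[OF assms] cross_Dx[OF assms]
  by fastforce

lemma \<xi>_cont: "c \<in> A \<Longrightarrow> continuous_on (chart_range c) (local_rep c \<xi>)"
  unfolding local_rep_def o_def
  by (rule continuous_on_compose2[OF _ continuous_on_chart_inv, of M])
    (use normal in \<open>simp add: unit_normal_field_def\<close>, assumption, blast intro: in_M)

lemma Dx_C1: "c \<in> A \<Longrightarrow> Ck_on 1 (D i c x) (chart_range c)"
  using x_C2[of c] by (simp add: numeral_2_eq_2 Ck_on.simps(2) One_nat_def)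

lemma x_C1: "c \<in> A \<Longrightarrow> Ck_on 1 (local_rep c x) (chart_range c)"
  using Ck_on_mono[OF x_C2] by simp

lemma y_C1: "c \<in> A \<Longrightarrow> Ck_on 1 (local_rep c y) (chart_range c)"
  using y_rel by (simp add: relative_normalization_def Ck_map_def)

lemma z_C1: "c \<in> A \<Longrightarrow> Ck_on 1 (local_rep c z) (chart_range c)"
  using z_rel by (simp add: relative_normalization_def Ck_map_def)

lemma vol_cont: "c \<in> A \<Longrightarrow> continuous_on (chart_range c) (vol c)"
  unfolding vol_def[abs_def]
  by (intro continuous_on_inner continuous_on_cross \<xi>_cont C1_continuous[OF Dx_C1])

text \<open>A unit normal field is by definition only continuous. It is recovered from the C^1 cross
  product of the tangent vectors, normalized and multiplied by the locally constant sign of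
  \<open>vol\<close>.\<close>

lemma \<xi>_C1:
  assumes c: "c \<in> A"
  shows "Ck_on 1 (local_rep c \<xi>) (chart_range c)"
proof -
  let ?n = "\<lambda>u. cross3 (D 1 c x u) (D 2 c x u)"
  have n: "Ck_on 1 ?n (chart_range c)" by (intro C1_cross Dx_C1 c)
  have n0: "?n u \<noteq> 0" if "u \<in> chart_range c" for u
    using independent_Dx[OF c that] by (intro cross3_nonzero)
  have "Ck_on 1 (\<lambda>u. (sgn (vol c u) / norm (?n u)) *\<^sub>R ?n u) (chart_range c)"
    using n n0 C1_sgn(1)[OF vol_cont[OF c] open_chart_range[OF c] vol_nonzero[OF c]]
    by (intro C1_scaleR C1_divide C1_norm) auto
  then show ?thesis
  proof (rule C1_transform_open[OF _ open_chart_range[OF c]])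
    fix u assume u: "u \<in> chart_range c"
    show "(sgn (vol c u) / norm (?n u)) *\<^sub>R ?n u = local_rep c \<xi> u"
      using vol_nonzero[OF c u] norm_\<xi>[OF c u]
      by (simp add: cross_Dx[OF c u] sgn_if)
  qed
qed

lemma tangent_Dy: "c \<in> A \<Longrightarrow> u \<in> chart_range c \<Longrightarrow> local_rep c \<xi> u \<bullet> D i c y u = 0"
  and tangent_Dz: "c \<in> A \<Longrightarrow> u \<in> chart_range c \<Longrightarrow> local_rep c \<xi> u \<bullet> D i c z u = 0"
proof -
  have *: "local_rep c \<xi> u \<bullet> D i c f u = 0"
    if f: "relative_normalization 1 A x f" and c: "c \<in> A" and u: "u \<in> chart_range c" for f
  proof -
    have "D i c f u \<in> span {D 1 c x u, D 2 c x u}"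
      using f c u unfolding relative_normalization_def by blast
    then obtain k1 k2 where "D i c f u - k1 *\<^sub>R D 1 c x u = k2 *\<^sub>R D 2 c x u"
      by (auto simp: span_insert)
    then have "D i c f u = k1 *\<^sub>R D 1 c x u + k2 *\<^sub>R D 2 c x u"
      by (simp add: algebra_simps)
    then show ?thesis by (simp add: inner_add_right \<xi>_Dx[OF c u])
  qed
  show "c \<in> A \<Longrightarrow> u \<in> chart_range c \<Longrightarrow> local_rep c \<xi> u \<bullet> D i c y u = 0"
    and "c \<in> A \<Longrightarrow> u \<in> chart_range c \<Longrightarrow> local_rep c \<xi> u \<bullet> D i c z u = 0"
    using * y_rel z_rel by auto
qed

text \<open>The definite description in \<open>relative_shape\<close> has to be resolved: tangency
  of the derivatives of \<open>f\<close> gives a matrix, independence of the tangent vectors makes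
  it unique. In \<open>shape_vol\<close> the off-diagonal entries then drop out, as they multiply
  products of a vector with itself.\<close>

lemma trace_relative_shape:
  assumes f: "relative_normalization 1 A x f" and c: "c \<in> A" and u: "u \<in> chart_range c"
  shows "trace (relative_shape c x f u) = - shape_vol c f u / vol c u"
proof -
  let ?a = "\<lambda>j. D j c x u"
  have "\<exists>b1 b2. D i c f u = - (b1 *\<^sub>R ?a 1 + b2 *\<^sub>R ?a 2)" for i
  proof -
    have "D i c f u \<in> span {?a 1, ?a 2}"
      using f c u unfolding relative_normalization_def by blast
    then obtain k1 k2 where "D i c f u - k1 *\<^sub>R ?a 1 = k2 *\<^sub>R ?a 2"
      by (auto simp: span_insert)
    then show ?thesis by (intro exI[of _ "-k1"] exI[of _ "-k2"]) (simp add: algebra_simps)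
  qed
  then obtain b1 b2 where b: "\<And>i. D i c f u = - (b1 i *\<^sub>R ?a 1 + b2 i *\<^sub>R ?a 2)"
    by metis
  let ?P = "\<lambda>B :: real^2^2. \<forall>i. D i c f u = - (\<Sum>j\<in>UNIV. (B $ i $ j) *\<^sub>R ?a j)"
  have "\<exists>!B. ?P B"
  proof
    show "?P (\<chi> i j. if j = 1 then b1 i else b2 i)"
      using b by (simp add: sum_2)
    fix B assume B: "?P B"
    have "B $ i $ 1 = b1 i \<and> B $ i $ 2 = b2 i" for i
    proof -
      have "(B $ i $ 1 - b1 i) *\<^sub>R ?a 1 + (B $ i $ 2 - b2 i) *\<^sub>R ?a 2 = 0"
        using B[rule_format, of i] b[of i] by (simp add: sum_2 algebra_simps)
      from independent_Dx[OF c u this] show ?thesis by simp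
    qed
    then show "B = (\<chi> i j. if j = 1 then b1 i else b2 i)"
      by (simp add: vec_eq_iff forall_2)
  qed
  then have "?P (relative_shape c x f u)"
    unfolding relative_shape_def by (rule theI')
  then have B: "D i c f u = - (relative_shape c x f u $ i $ 1 *\<^sub>R ?a 1 + relative_shape c x f u $ i $ 2 *\<^sub>R ?a 2)" for i
    by (simp add: sum_2)
  have "shape_vol c f u = - trace (relative_shape c x f u) * vol c u"
    unfolding shape_vol_def vol_def B[of 1] B[of 2] trace_def sum_2
    by (simp add: cross_add_left cross_add_right cross_mult_left cross_mult_right inner_add_left algebra_simps
        Cross3.left_diff_distrib Cross3.right_diff_distrib)
  then show ?thesis using vol_nonzero[OF c u] by (simp add: field_simps)
qed

section \<open>Change of chart, curvatures and the density of II\<close>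

definition jac :: "'a chart \<Rightarrow> 'a chart \<Rightarrow> 'a \<Rightarrow> real" where
  "jac c d p = det (matrix (frechet_derivative (local_rep c (snd d)) (at (snd c p))))"

lemma partial_local_rep_eq:
  assumes "c \<in> A" "p \<in> fst c" "d \<in> A" "p \<in> fst d" "Ck_on 1 (local_rep d f) (chart_range d)"
  shows "D i c f (snd c p) = D i c (snd d) (snd c p) $ 1 *\<^sub>R D 1 d f (snd d p)
    + D i c (snd d) (snd c p) $ 2 *\<^sub>R D 2 d f (snd d p)"
  using partial_local_rep_overlap[OF assms(1-4) C1_differentiable[OF assms(5)]] assms(4)
  by (simp add: sum_2)

lemma jac_eq:
  "jac c d p = D 1 c (snd d) (snd c p) $ 1 * D 2 c (snd d) (snd c p) $ 2
    - D 1 c (snd d) (snd c p) $ 2 * D 2 c (snd d) (snd c p) $ 1"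
  by (simp add: jac_def det_2 matrix_def partial_def)

context
  fixes c d p
  assumes c: "c \<in> A" "p \<in> fst c" and d: "d \<in> A" "p \<in> fst d"
begin

lemma vol_transfer: "vol c (snd c p) = jac c d p * vol d (snd d p)"
  using c d
  by (simp add: vol_def partial_local_rep_eq[OF c d x_C1[OF d(1)]] cross3_self_change_basis jac_eq)

lemma jac_nonzero: "jac c d p \<noteq> 0"
  using vol_transfer vol_nonzero[OF c(1), of "snd c p"] c by auto

lemma shape_vol_transfer:
  assumes "Ck_on 1 (local_rep d f) (chart_range d)"
  shows "shape_vol c f (snd c p) = jac c d p * shape_vol d f (snd d p)"
  using c d cross3_change_basis
  by (simp add: shape_vol_def partial_local_rep_eq[OF c d x_C1[OF d(1)]] partial_local_rep_eq[OF c d assms] jac_eq add.commute)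

end

text \<open>\<open>shape_vol\<close> and \<open>vol\<close> pick up the same Jacobian determinant,
  so the value taken from \<open>chart_at\<close> may be computed in any chart around
  \<open>p\<close>.\<close>

lemma mean_relative_curvature_eq:
  assumes f: "relative_normalization 1 A x f" and c: "c \<in> A" "p \<in> fst c"
  shows "mean_relative_curvature A x f p = - shape_vol c f (snd c p) / (2 * vol c (snd c p))"
proof -
  have p: "p \<in> M" using c chart_subset by blast
  note d = chart_at[OF p]
  have f1: "Ck_on 1 (local_rep c f) (chart_range c)"
    using f c by (simp add: relative_normalization_def Ck_map_def)
  have "mean_relative_curvature A x f p
      = - shape_vol (chart_at A p) f (snd (chart_at A p) p) / vol (chart_at A p) (snd (chart_at A p) p) / 2"
    using d by (simp add: mean_relative_curvature_def Let_def trace_relative_shape[OF f])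
  then show ?thesis
    using jac_nonzero[OF d c]
    by (simp add: vol_transfer[OF d c] shape_vol_transfer[OF d c f1])
qed

text \<open>Differentiating <\<xi>, x_i> = 0. Since the right-hand side contains first derivatives
  only, a change of chart brings in no second derivatives of the transition map.\<close>

lemma second_form_eq:
  assumes c: "c \<in> A" and u: "u \<in> chart_range c"
  shows "second_form c x \<xi> u $ i $ j = - (D j c \<xi> u \<bullet> D i c x u)"
proof -
  have "partial j (\<lambda>u. local_rep c \<xi> u \<bullet> D i c x u) u = partial j (\<lambda>_. 0) u"
    by (rule partial_cong_open[OF open_chart_range[OF c] u]) (rule \<xi>_Dx[OF c])
  then have "local_rep c \<xi> u \<bullet> partial j (D i c x) u + D j c \<xi> u \<bullet> D i c x u = 0"
    by (simp add: partial_inner C1_differentiable[OF \<xi>_C1[OF c] u] C1_differentiable[OF Dx_C1[OF c] u]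
        partial_eq[OF has_derivative_const])
  then show ?thesis by (simp add: second_form_def)
qed

lemma det_second_form:
  assumes c: "c \<in> A" and u: "u \<in> chart_range c"
  shows "det (second_form c x \<xi> u) = cross3 (D 1 c x u) (D 2 c x u) \<bullet> cross3 (D 1 c \<xi> u) (D 2 c \<xi> u)"
  by (simp add: det_2 second_form_eq[OF assms] cross3_dot_cross3 inner_commute algebra_simps)

lemma det_first_form:
  assumes c: "c \<in> A" and u: "u \<in> chart_range c"
  shows "det (first_form c x u) = (vol c u)\<^sup>2"
proof -
  have "det (first_form c x u) = cross3 (D 1 c x u) (D 2 c x u) \<bullet> cross3 (D 1 c x u) (D 2 c x u)"
    by (simp add: det_2 first_form_def cross3_dot_cross3)
  then show ?thesis
    using norm_\<xi>[OF assms] by (simp add: cross_Dx[OF assms] power2_eq_square dot_square_norm)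
qed

text \<open>Both determinants scale by the square of the Jacobian: the numerator as an inner product
  of two cross products, the denominator as the square of \<open>vol\<close>.\<close>

lemma gauss_curvature_eq:
  assumes c: "c \<in> A" "p \<in> fst c"
  shows "gauss_curvature A x \<xi> p = det (second_form c x \<xi> (snd c p)) / (vol c (snd c p))\<^sup>2"
proof -
  have p: "p \<in> M" using c chart_subset by blast
  note d = chart_at[OF p]
  let ?d = "chart_at A p"
  have "det (second_form ?d x \<xi> (snd ?d p)) = (jac ?d c p)\<^sup>2 * det (second_form c x \<xi> (snd c p))"
    using c d
    by (simp add: det_second_form partial_local_rep_eq[OF d c x_C1[OF c(1)]] partial_local_rep_eq[OF d c \<xi>_C1[OF c(1)]]
        cross3_self_change_basis jac_eq power2_eq_square)
  then show ?thesis
    using d jac_nonzero[OF d c]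
    by (simp add: gauss_curvature_def Let_def det_first_form vol_transfer[OF d c] power_mult_distrib)
qed

lemma sqrt_det_second_form:
  assumes c: "c \<in> A" and u: "u \<in> chart_range c"
  shows "sqrt (det (second_form c x \<xi> u)) = (local_rep c \<xi> u \<bullet> local_rep c z u)\<^sup>2 * \<bar>vol c u\<bar>"
proof -
  let ?p = "chart_inv c u"
  have p: "?p \<in> fst c" "?p \<in> M" "snd c ?p = u" using u in_M[OF c u] by auto
  let ?q = "local_rep c \<xi> u \<bullet> local_rep c z u"
  have q: "?q = support_fun \<xi> z ?p" by (simp add: support_fun_def local_rep_apply)
  have "?q ^ 4 = gauss_curvature A x \<xi> ?p"
    unfolding q z_aff[OF p(2)] using K_pos[OF p(2)]
    by (simp add: powr_power)
  then have "det (second_form c x \<xi> u) = (?q\<^sup>2 * vol c u)\<^sup>2"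
    using gauss_curvature_eq[OF c p(1)] vol_nonzero[OF c u] p(3)
    by (simp add: field_simps power_mult_distrib)
  then show ?thesis by (simp add: abs_mult)
qed

end

subsection \<open>The flux of the difference of two relative normalizations\<close>

context relative_pair
begin

abbreviation q :: "'a \<Rightarrow> real" where "q \<equiv> support_fun \<xi> y"
abbreviation qz :: "'a \<Rightarrow> real" where "qz \<equiv> support_fun \<xi> z"

definition ratio :: "'a \<Rightarrow> real" where "ratio p = q p / qz p"

definition curv_diff :: "'a \<Rightarrow> real" where
  "curv_diff p = mean_relative_curvature A x y p / q p - mean_relative_curvature A x z p / qz p"

text \<open>The components of the tangent vector field \<open>y - ratio \<cdot> z\<close>, multiplied by \<open>vol \<cdot> qz\<close>.\<close>

definition flux :: "'a chart \<Rightarrow> 2 \<Rightarrow> real^2 \<Rightarrow> real" where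
  "flux c i u = (if i = 1 then cross3 (local_rep c y u) (D 2 c x u) else cross3 (D 1 c x u) (local_rep c y u))
     \<bullet> local_rep c z u"

text \<open>The derivative df(Z) along Z = y - \<open>ratio\<close> z, where \<open>ratio\<close> is
  the function w; the division undoes the factor contained in \<open>flux\<close>.\<close>

definition flow_chart :: "'a chart \<Rightarrow> ('a \<Rightarrow> real) \<Rightarrow> real^2 \<Rightarrow> real" where
  "flow_chart c f u = (flux c 1 u * D 1 c f u + flux c 2 u * D 2 c f u) / (vol c u * local_rep c qz u)"

definition flow :: "('a \<Rightarrow> real) \<Rightarrow> 'a \<Rightarrow> real" where
  "flow f p = flow_chart (chart_at A p) f (snd (chart_at A p) p)"

lemma local_rep_q: "local_rep c q u = local_rep c \<xi> u \<bullet> local_rep c y u"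
  and local_rep_qz: "local_rep c qz u = local_rep c \<xi> u \<bullet> local_rep c z u"
  by (simp_all add: support_fun_def local_rep_apply)

lemma local_q_pos: "c \<in> A \<Longrightarrow> u \<in> chart_range c \<Longrightarrow> 0 < local_rep c q u"
  and local_qz_pos: "c \<in> A \<Longrightarrow> u \<in> chart_range c \<Longrightarrow> 0 < local_rep c qz u"
  using y_pos z_pos in_M by (simp_all add: local_rep_apply)

lemma q_C1: "C1_on_surface q" and qz_C1: "C1_on_surface qz"
  unfolding C1_on_surface_def local_rep_q[abs_def] local_rep_qz[abs_def]
  by (auto intro!: C1_inner \<xi>_C1 y_C1 z_C1)

lemma ratio_pos: "p \<in> M \<Longrightarrow> 0 < ratio p"
  using y_pos z_pos by (simp add: ratio_def)

lemma ratio_C1: "C1_on_surface ratio"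
  unfolding ratio_def[abs_def] using z_pos by (intro C1_on_surface_divide q_C1 qz_C1) fastforce

lemma flux_C1: "c \<in> A \<Longrightarrow> Ck_on 1 (flux c i) (chart_range c)"
  unfolding flux_def[abs_def] by (cases "i = 1") (auto intro!: C1_inner C1_cross Dx_C1 y_C1 z_C1)

text \<open>The terms with the mixed derivative of \<open>x\<close> cancel. Those with derivatives
  of \<open>y\<close> are paired with \<open>z\<close>, those with derivatives of \<open>z\<close>
  with \<open>y\<close>; as both factors of each remaining cross product are tangent, the pairing
  splits off \<open>qz\<close> or \<open>q\<close>.\<close>

lemma flux_divergence:
  assumes c: "c \<in> A" and u: "u \<in> chart_range c"
  shows "partial 1 (flux c 1) u + partial 2 (flux c 2) u
    = shape_vol c y u * local_rep c qz u - shape_vol c z u * local_rep c q u"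
proof -
  note d = C1_differentiable[OF y_C1[OF c] u] C1_differentiable[OF z_C1[OF c] u]
    C1_differentiable[OF Dx_C1[OF c] u]
  note dc = C1_differentiable[OF C1_cross[OF y_C1[OF c] Dx_C1[OF c]] u]
    C1_differentiable[OF C1_cross[OF Dx_C1[OF c] y_C1[OF c]] u]
  let ?y = "local_rep c y u" and ?z = "local_rep c z u" and ?\<xi> = "local_rep c \<xi> u"
  let ?a = "\<lambda>i. D i c x u" and ?b = "\<lambda>i. D i c y u" and ?e = "\<lambda>i. D i c z u"
  let ?m = "partial 1 (D 2 c x) u"
  have sym: "partial 2 (D 1 c x) u = ?m"
    by (rule partial_commute[OF x_C2[OF c] open_chart_range[OF c] u])
  have "partial 1 (flux c 1) u = cross3 ?y (?a 2) \<bullet> ?e 1 + (cross3 ?y ?m + cross3 (?b 1) (?a 2)) \<bullet> ?z"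
    unfolding flux_def[abs_def] by (simp add: partial_inner partial_cross d dc)
  moreover have "partial 2 (flux c 2) u = cross3 (?a 1) ?y \<bullet> ?e 2 + (cross3 (?a 1) (?b 2) + cross3 ?m ?y) \<bullet> ?z"
    unfolding flux_def[abs_def] by (simp add: partial_inner partial_cross d dc sym)
  moreover have "cross3 ?m ?y = - cross3 ?y ?m" by (rule cross_skew)
  \<comment> \<open>Exchanging two entries of a triple product moves the derivative of
    \<open>z\<close> into the cross product, at the price of a sign.\<close>
  moreover have "cross3 ?y (?a 2) \<bullet> ?e 1 = - (cross3 (?e 1) (?a 2) \<bullet> ?y)"
    "cross3 (?a 1) ?y \<bullet> ?e 2 = - (cross3 (?a 1) (?e 2) \<bullet> ?y)"
    by (simp_all add: cross3_simps)
  ultimately have 1: "partial 1 (flux c 1) u + partial 2 (flux c 2) u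
      = (cross3 (?b 1) (?a 2) + cross3 (?a 1) (?b 2)) \<bullet> ?z - (cross3 (?e 1) (?a 2) + cross3 (?a 1) (?e 2)) \<bullet> ?y"
    by (simp add: inner_add_left inner_diff_left)
  have "cross3 (?b 1) (?a 2) \<bullet> v = (cross3 (?b 1) (?a 2) \<bullet> ?\<xi>) * (?\<xi> \<bullet> v)"
    "cross3 (?a 1) (?b 2) \<bullet> v = (cross3 (?a 1) (?b 2) \<bullet> ?\<xi>) * (?\<xi> \<bullet> v)"
    "cross3 (?e 1) (?a 2) \<bullet> v = (cross3 (?e 1) (?a 2) \<bullet> ?\<xi>) * (?\<xi> \<bullet> v)"
    "cross3 (?a 1) (?e 2) \<bullet> v = (cross3 (?a 1) (?e 2) \<bullet> ?\<xi>) * (?\<xi> \<bullet> v)" for v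
    by (intro cross3_dot_eq norm_\<xi>[OF c u] \<xi>_Dx[OF c u] tangent_Dy[OF c u] tangent_Dz[OF c u])+
  from this[of ?z] this[of ?y] show ?thesis
    unfolding 1 shape_vol_def local_rep_q local_rep_qz by (simp add: inner_add_left algebra_simps)
qed

text \<open>The contraction of \<open>flux\<close> with df and the factor \<open>vol\<close> both
  acquire the Jacobian determinant, while \<open>qz\<close> does not depend on the chart; hence
  df(Z) is a function on the surface.\<close>

lemma flow_eq:
  assumes f: "C1_on_surface f" and c: "c \<in> A" "p \<in> fst c"
  shows "flow f p = flow_chart c f (snd c p)"
proof -
  have p: "p \<in> M" using c chart_subset by blast
  note d = chart_at[OF p]
  let ?d = "chart_at A p"
  have "flux ?d 1 (snd ?d p) * D 1 ?d f (snd ?d p) + flux ?d 2 (snd ?d p) * D 2 ?d f (snd ?d p)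
    = jac ?d c p * (flux c 1 (snd c p) * D 1 c f (snd c p) + flux c 2 (snd c p) * D 2 c f (snd c p))"
    using c d
    by (simp add: flux_def partial_local_rep_eq[OF d c x_C1[OF c(1)]] partial_local_rep_eq[OF d c C1_on_surfaceD[OF f c(1)]]
        jac_eq cross_add_left cross_add_right cross_mult_left cross_mult_right inner_add_left
        cross_skew[of _ "y p"] algebra_simps)
  then show ?thesis
    using c d jac_nonzero[OF d c] by (simp add: flow_def flow_chart_def vol_transfer[OF d c])
qed

lemma curv_diff_eq:
  assumes c: "c \<in> A" and u: "u \<in> chart_range c"
  shows "local_rep c curv_diff u = shape_vol c z u / (2 * vol c u * local_rep c qz u)
    - shape_vol c y u / (2 * vol c u * local_rep c q u)"
proof -
  have p: "chart_inv c u \<in> fst c" "snd c (chart_inv c u) = u" using u by auto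
  show ?thesis
    using mean_relative_curvature_eq[OF y_rel c p(1)] mean_relative_curvature_eq[OF z_rel c p(1)] p(2)
    by (simp add: curv_diff_def local_rep_apply)
qed

lemma shape_vol_cont:
  assumes "c \<in> A" "Ck_on 1 (local_rep c f) (chart_range c)"
  shows "continuous_on (chart_range c) (shape_vol c f)"
  unfolding shape_vol_def[abs_def]
  by (intro continuous_on_inner continuous_on_add continuous_on_cross \<xi>_cont
      C1_continuous_partial[OF x_C1] C1_continuous_partial[OF assms(2)] assms(1))

lemma curv_diff_cont:
  assumes c: "c \<in> A"
  shows "continuous_on (chart_range c) (local_rep c curv_diff)"
proof -
  have "continuous_on (chart_range c) (\<lambda>u. shape_vol c z u / (2 * vol c u * local_rep c qz u)
    - shape_vol c y u / (2 * vol c u * local_rep c q u))"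
    using vol_nonzero[OF c] local_q_pos[OF c] local_qz_pos[OF c] c
    by (intro continuous_on_diff continuous_on_divide continuous_on_mult continuous_on_const
        shape_vol_cont vol_cont y_C1 z_C1 C1_continuous[OF C1_on_surfaceD] q_C1 qz_C1) (auto simp: less_le)
  then show ?thesis
    using curv_diff_eq[OF c] by (subst continuous_on_cong) auto
qed

lemma flow_chart_cont:
  assumes f: "C1_on_surface f" and c: "c \<in> A"
  shows "continuous_on (chart_range c) (flow_chart c f)"
  unfolding flow_chart_def[abs_def]
  using vol_nonzero[OF c] local_qz_pos[OF c] c
  by (intro continuous_on_divide continuous_on_add continuous_on_mult C1_continuous[OF flux_C1]
      C1_continuous_partial[OF C1_on_surfaceD[OF f]] vol_cont C1_continuous[OF C1_on_surfaceD[OF qz_C1]])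
    (auto simp: less_le)

lemma local_rep_flow:
  assumes f: "C1_on_surface f" and c: "c \<in> A" and u: "u \<in> chart_range c"
  shows "local_rep c (flow f) u = flow_chart c f u"
  using flow_eq[OF f c, of "chart_inv c u"] u by (simp add: local_rep_apply)

lemma flow_cont:
  assumes f: "C1_on_surface f" and c: "c \<in> A"
  shows "continuous_on (chart_range c) (local_rep c (flow f))"
  using flow_chart_cont[OF assms] local_rep_flow[OF assms] by (subst continuous_on_cong) auto

lemma flow_zero:
  assumes f: "C1_on_surface f" and K: "compact K" and f0: "\<And>p. p \<in> M - K \<Longrightarrow> f p = 0" and p: "p \<in> M - K"
  shows "flow f p = 0"
proof -
  obtain c where c: "c \<in> A" "p \<in> fst c" using p charts_cover by blast
  \<comment> \<open>\<open>K\<close> may reach outside \<open>M\<close>, hence the intersection. Its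
    complement is relatively open, so \<open>f\<close> vanishes near \<open>p\<close> and not merely
    at \<open>p\<close>.\<close>
  have "closedin (top_of_set M) (M \<inter> K)"
    using K by (auto intro: closedin_closed_Int compact_imp_closed)
  then have "openin (top_of_set M) (M - M \<inter> K)"
    by (metis openin_diff openin_subtopology_self)
  moreover have "M - M \<inter> K = M - K" by blast
  ultimately have o: "open (snd c ` (fst c \<inter> (M - K)))"
    using open_chart_image[OF c(1)] by simp
  have "D i c f (snd c p) = 0" for i
  proof -
    have "D i c f (snd c p) = partial i (\<lambda>_. 0) (snd c p)"
      by (rule partial_cong_open[OF o]) (use c p f0 in auto)
    then show ?thesis by (simp add: partial_eq[OF has_derivative_const])
  qed
  then show ?thesis by (simp add: flow_eq[OF f c] flow_chart_def)
qed

text \<open>The density is the square of \<open>qz\<close> times the absolute value of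
  \<open>vol\<close>. The first factor is a function on the surface and the second changes by the
  absolute Jacobian, which is the transformation law.\<close>

sublocale surface_density M A "\<lambda>c u. sqrt (det (second_form c x \<xi> u))"
proof
  fix c assume c: "c \<in> A"
  have "continuous_on (chart_range c) (\<lambda>u. (local_rep c qz u)\<^sup>2 * \<bar>vol c u\<bar>)"
    by (intro continuous_intros vol_cont c C1_continuous[OF C1_on_surfaceD[OF qz_C1 c]])
  then show "continuous_on (chart_range c) (\<lambda>u. sqrt (det (second_form c x \<xi> u)))"
    using sqrt_det_second_form[OF c] by (subst continuous_on_cong) (auto simp: local_rep_qz)
  show "0 < sqrt (det (second_form c x \<xi> u))" if u: "u \<in> chart_range c" for u
    using local_qz_pos[OF c u] vol_nonzero[OF c u] unfolding sqrt_det_second_form[OF c u] local_rep_qz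
    by simp
  fix d p assume d: "d \<in> A" and p: "p \<in> fst c" "p \<in> fst d"
  show "sqrt (det (second_form c x \<xi> (snd c p)))
      = \<bar>det (matrix (frechet_derivative (local_rep c (snd d)) (at (snd c p))))\<bar>
        * sqrt (det (second_form d x \<xi> (snd d p)))"
    using c d p
    by (simp add: sqrt_det_second_form vol_transfer[OF c p(1) d p(2)] abs_mult jac_def)
qed

section \<open>The area measure of II and Stokes' theorem for the flux\<close>

lemma area_II_eq: "area_II M A x \<xi> = (THE \<mu>. has_density \<mu>)"
  by (simp add: area_II_def has_density_def)

lemma has_density_area_II: "has_density (area_II M A x \<xi>)"
  unfolding area_II_eq by (rule has_density_The)

abbreviation \<mu> :: "'a measure" where "\<mu> \<equiv> area_II M A x \<xi>"

text \<open>For \<open>f\<close> supported in one chart, the difference of the two integrands (the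
  second doubled) times the density is the coordinate divergence of sgn(vol) f flux: the product
  rule yields df along the flux and f times the divergence of the flux. Compact support makes the
  integral of this divergence vanish.\<close>

lemma stokes_chart:
  assumes c: "c \<in> A" and K: "compact K" "K \<subseteq> fst c"
    and f: "C1_on_surface f" and f0: "\<And>p. p \<in> M - K \<Longrightarrow> f p = 0"
  shows "integrable \<mu> (\<lambda>p. flow f p / qz p)" "integrable \<mu> (\<lambda>p. ratio p * curv_diff p * f p)"
    "(LINT p|\<mu>. flow f p / qz p) = 2 * (LINT p|\<mu>. ratio p * curv_diff p * f p)"
proof -
  let ?R = "chart_range c"
  note supp = integral_chart_support[OF has_density_area_II c K]
  note cf = C1_on_surfaceD[OF f c]
  let ?g1 = "\<lambda>p. flow f p / qz p" and ?g2 = "\<lambda>p. ratio p * curv_diff p * f p"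
  have 1: "continuous_on ?R (local_rep c ?g1)"
    using flow_cont[OF f c] C1_continuous[OF C1_on_surfaceD[OF qz_C1 c]] local_qz_pos[OF c]
    unfolding local_rep_def o_def by (intro continuous_on_divide) (auto simp: less_le)
  have 2: "continuous_on ?R (local_rep c ?g2)"
    using curv_diff_cont[OF c] C1_continuous[OF C1_on_surfaceD[OF ratio_C1 c]] C1_continuous[OF cf]
    unfolding local_rep_def o_def by (intro continuous_on_mult) auto
  have z1: "?g1 p = 0" and z2: "?g2 p = 0" if "p \<in> M - K" for p
    using flow_zero[OF f K(1) f0 that] f0[OF that] by auto
  show i: "integrable \<mu> ?g1" "integrable \<mu> ?g2"
    by (rule supp(1)[OF 1 z1] supp(1)[OF 2 z2]; assumption)+
  have "continuous_on ?R (local_rep c (\<lambda>p. ?g1 p - 2 * ?g2 p))"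
    using continuous_on_diff[OF 1 continuous_on_mult[OF continuous_on_const[of _ 2] 2]]
    unfolding local_rep_def o_def .
  from supp(2)[OF this] z1 z2
  have "(LINT p|\<mu>. ?g1 p - 2 * ?g2 p) = (LINT u|lborel. indicator ?R u *
      (local_rep c (\<lambda>p. ?g1 p - 2 * ?g2 p) u * sqrt (det (second_form c x \<xi> u))))"
    by simp
  also have "\<dots> = (LINT u|lborel. indicator ?R u * partial 1 (\<lambda>u. sgn (vol c u) * (flux c 1 u * local_rep c f u)) u
      + indicator ?R u * partial 2 (\<lambda>u. sgn (vol c u) * (flux c 2 u * local_rep c f u)) u)"
  proof (intro Bochner_Integration.integral_cong refl)
    fix u
    show "indicator ?R u * (local_rep c (\<lambda>p. ?g1 p - 2 * ?g2 p) u * sqrt (det (second_form c x \<xi> u)))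
      = indicator ?R u * partial 1 (\<lambda>u. sgn (vol c u) * (flux c 1 u * local_rep c f u)) u
      + indicator ?R u * partial 2 (\<lambda>u. sgn (vol c u) * (flux c 2 u * local_rep c f u)) u"
    proof (cases "u \<in> ?R")
      case u: True
      note s = C1_sgn[OF vol_cont[OF c] open_chart_range[OF c] vol_nonzero[OF c]]
      note ds = C1_differentiable[OF s(1) u] and df = C1_differentiable[OF cf u]
        and dfl = C1_differentiable[OF flux_C1[OF c] u]
      note dm = C1_differentiable[OF C1_mult[OF flux_C1[OF c] cf] u]
      \<comment> \<open>The derivatives of the sign vanish, so it stays outside as a plain
        factor.\<close>
      have p: "partial i (\<lambda>u. sgn (vol c u) * (flux c i u * local_rep c f u)) u
        = sgn (vol c u) * (flux c i u * D i c f u + partial i (flux c i) u * local_rep c f u)" for i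
        using s(2)[OF _ u, of i] by (simp add: partial_mult ds dm df dfl)
      let ?Q = "local_rep c qz u" and ?q = "local_rep c q u" and ?v = "vol c u"
      have pos: "?Q > 0" "?q > 0" "?v \<noteq> 0"
        using local_q_pos[OF c u] local_qz_pos[OF c u] vol_nonzero[OF c u] by auto
      have l1: "local_rep c (\<lambda>p. ?g1 p - 2 * ?g2 p) u
          = flow_chart c f u / ?Q - 2 * (?q / ?Q * local_rep c curv_diff u * local_rep c f u)"
        using local_rep_flow[OF f c u] by (simp add: local_rep_apply ratio_def)
      \<comment> \<open>The square of \<open>?Q\<close> from the density absorbs the denominators,
        and the absolute value of \<open>?v\<close> is rewritten as
        \<open>sgn ?v * ?v\<close>.\<close>
      have "local_rep c (\<lambda>p. ?g1 p - 2 * ?g2 p) u * sqrt (det (second_form c x \<xi> u))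
        = (flow_chart c f u / ?Q - 2 * (?q / ?Q * local_rep c curv_diff u * local_rep c f u)) * (?Q\<^sup>2 * (sgn ?v * ?v))"
        unfolding l1 sqrt_det_second_form[OF c u] local_rep_qz by (simp add: abs_sgn mult.commute)
      also have "\<dots> = sgn ?v * (flow_chart c f u * (?v * ?Q)
          + local_rep c f u * (- 2 * ?v * ?q * ?Q * local_rep c curv_diff u))"
        using pos by (simp add: field_simps power2_eq_square)
      also have "flow_chart c f u * (?v * ?Q) = flux c 1 u * D 1 c f u + flux c 2 u * D 2 c f u"
        using pos by (simp add: flow_chart_def)
      also have "- 2 * ?v * ?q * ?Q * local_rep c curv_diff u = partial 1 (flux c 1) u + partial 2 (flux c 2) u"
        unfolding flux_divergence[OF c u] curv_diff_eq[OF c u] using pos by (simp add: field_simps)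
      finally show ?thesis using u unfolding p[of 1] p[of 2] by (simp add: algebra_simps)
    qed simp
  qed
  also have "\<dots> = 0"
  proof -
    have KK: "compact (snd c ` K)" "snd c ` K \<subseteq> ?R"
      using K by (auto intro!: compact_continuous_image continuous_on_subset[OF continuous_on_chart[OF c]])
    have C1: "Ck_on 1 (\<lambda>u. sgn (vol c u) * (flux c i u * local_rep c f u)) ?R" for i
      by (intro C1_mult C1_sgn(1) vol_cont open_chart_range vol_nonzero flux_C1 cf c)
    have 0: "sgn (vol c u) * (flux c i u * local_rep c f u) = 0" if u: "u \<in> ?R - snd c ` K" for u i
    proof -
      obtain p where p: "p \<in> fst c" "u = snd c p" using u by blast
      then have "p \<in> M - K" using u chart_subset[OF c] by blast
      then show ?thesis using f0 p c by simp
    qed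
    note int = integral_partial_compact_support_open[OF open_chart_range[OF c] C1 KK 0]
    show ?thesis by (subst Bochner_Integration.integral_add) (use int in auto)
  qed
  finally have "(LINT p|\<mu>. ?g1 p - 2 * ?g2 p) = 0" .
  then show "(LINT p|\<mu>. ?g1 p) = 2 * (LINT p|\<mu>. ?g2 p)"
    using i by simp
qed

text \<open>Linearity of f in df(Z). Equality on \<open>M\<close> suffices, since a chart range
  shows only points of \<open>M\<close>; a partition of unity sums to one in exactly this
  sense.\<close>

lemma flow_sum:
  assumes "finite I" "\<And>t. t \<in> I \<Longrightarrow> C1_on_surface (f t)" "C1_on_surface g"
    and eq: "\<And>p. p \<in> M \<Longrightarrow> g p = (\<Sum>t\<in>I. f t p)" and p: "p \<in> M"
  shows "flow g p = (\<Sum>t\<in>I. flow (f t) p)"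
proof -
  note c = chart_at[OF p]
  let ?c = "chart_at A p"
  let ?u = "snd ?c p"
  have u: "?u \<in> chart_range ?c" using c by blast
  have "D i ?c g ?u = (\<Sum>t\<in>I. D i ?c (f t) ?u)" for i
  proof -
    have "D i ?c g ?u = partial i (\<lambda>u. \<Sum>t\<in>I. local_rep ?c (f t) u) ?u"
      by (rule partial_cong_open[OF open_chart_range[OF c(1)] u])
        (use eq in_M[OF c(1)] in \<open>simp add: local_rep_apply\<close>)
    also have "\<dots> = (\<Sum>t\<in>I. D i ?c (f t) ?u)"
    proof -
      have "(local_rep ?c (f t) has_derivative frechet_derivative (local_rep ?c (f t)) (at ?u)) (at ?u)" if "t \<in> I" for t
        using C1_differentiable[OF C1_on_surfaceD[OF assms(2)[OF that] c(1)] u] by (simp add: frechet_derivative_works)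
      from partial_eq[OF has_derivative_sum[OF this]] show ?thesis by (simp add: partial_def)
    qed
    finally show ?thesis .
  qed
  then show ?thesis
    by (simp add: flow_def flow_chart_def sum_distrib_left sum.distrib flip: sum_divide_distrib)
qed

lemma recip_ratio_C1: "C1_on_surface (\<lambda>p. 1 / ratio p)"
  using ratio_pos by (intro C1_on_surface_divide ratio_C1) (auto simp: C1_on_surface_def local_rep_def o_def less_le)

text \<open>The chartwise identity is applied to each piece \<open>\<psi> t\<close> divided by
  \<open>ratio\<close>, which cancels the factor \<open>ratio\<close> in front of
  \<open>curv_diff\<close>. Integrability is recorded because a nonintegrable function has integral
  0 by convention, and a vanishing integral would then carry no information.\<close>

lemma integral_curv_diff:
  shows "integrable \<mu> (\<lambda>p. flow (\<lambda>p. 1 / ratio p) p / qz p)" "integrable \<mu> curv_diff"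
    "(LINT p|\<mu>. flow (\<lambda>p. 1 / ratio p) p / qz p) = 2 * (LINT p|\<mu>. curv_diff p)"
proof -
  obtain I :: "'a set" and c :: "'a \<Rightarrow> 'a chart" and K :: "'a \<Rightarrow> 'a set" and \<psi> :: "'a \<Rightarrow> 'a \<Rightarrow> real"
    where I: "finite I" and c: "\<forall>t\<in>I. c t \<in> A \<and> compact (K t) \<and> K t \<subseteq> fst (c t)"
      and \<psi>: "\<forall>t\<in>I. C1_on_surface (\<psi> t) \<and> (\<forall>q\<in>M - K t. \<psi> t q = 0)"
      and sum1: "\<forall>q\<in>M. (\<Sum>t\<in>I. \<psi> t q) = 1"
    using partition_of_unity .
  define f where "f t p = \<psi> t p * (1 / ratio p)" for t p
  have f_C1: "C1_on_surface (f t)" if "t \<in> I" for t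
    unfolding f_def[abs_def] using \<psi> that recip_ratio_C1 by (intro C1_on_surface_mult) auto
  have st: "integrable \<mu> (\<lambda>p. flow (f t) p / qz p)" "integrable \<mu> (\<lambda>p. ratio p * curv_diff p * f t p)"
      "(LINT p|\<mu>. flow (f t) p / qz p) = 2 * (LINT p|\<mu>. ratio p * curv_diff p * f t p)" if t: "t \<in> I" for t
  proof -
    have 1: "c t \<in> A" "compact (K t)" "K t \<subseteq> fst (c t)" using c t by auto
    have 2: "f t p = 0" if "p \<in> M - K t" for p using \<psi> t that by (simp add: f_def)
    from stokes_chart[OF 1 f_C1[OF t] 2]
    show "integrable \<mu> (\<lambda>p. flow (f t) p / qz p)" "integrable \<mu> (\<lambda>p. ratio p * curv_diff p * f t p)"
      "(LINT p|\<mu>. flow (f t) p / qz p) = 2 * (LINT p|\<mu>. ratio p * curv_diff p * f t p)" by auto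
  qed
  have sp: "space \<mu> = M"
    using sets_eq_imp_space_eq[OF sets_density_measure[OF has_density_area_II]] by (simp add: space_restrict_space)
  have A: "flow (\<lambda>p. 1 / ratio p) p / qz p = (\<Sum>t\<in>I. flow (f t) p / qz p)" if "p \<in> space \<mu>" for p
  proof -
    have "1 / ratio p = (\<Sum>t\<in>I. f t p)" if "p \<in> M" for p
      using sum1 that by (simp add: f_def flip: sum_divide_distrib)
    then show ?thesis
      using flow_sum[OF I f_C1 recip_ratio_C1] that sp by (simp add: sum_divide_distrib)
  qed
  have B: "curv_diff p = (\<Sum>t\<in>I. ratio p * curv_diff p * f t p)" if "p \<in> space \<mu>" for p
  proof -
    have "ratio p * curv_diff p * f t p = curv_diff p * \<psi> t p" for t
      using ratio_pos[of p] that sp by (simp add: f_def)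
    then have "(\<Sum>t\<in>I. ratio p * curv_diff p * f t p) = (\<Sum>t\<in>I. curv_diff p * \<psi> t p)"
      by (simp only:)
    also have "\<dots> = curv_diff p" using sum1 that sp by (simp flip: sum_distrib_left)
    finally show ?thesis ..
  qed
  show "integrable \<mu> (\<lambda>p. flow (\<lambda>p. 1 / ratio p) p / qz p)"
    by (rule Bochner_Integration.integrable_cong[THEN iffD2, OF refl A Bochner_Integration.integrable_sum[OF st(1)]])
  show "integrable \<mu> curv_diff"
    by (rule Bochner_Integration.integrable_cong[THEN iffD2, OF refl B Bochner_Integration.integrable_sum[OF st(2)]])
  have "(LINT p|\<mu>. flow (\<lambda>p. 1 / ratio p) p / qz p) = (\<Sum>t\<in>I. LINT p|\<mu>. flow (f t) p / qz p)"
    using st(1) by (subst Bochner_Integration.integral_cong[OF refl A]) (auto intro: Bochner_Integration.integral_sum)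
  also have "\<dots> = 2 * (\<Sum>t\<in>I. LINT p|\<mu>. ratio p * curv_diff p * f t p)"
    using st(3) by (simp add: sum_distrib_left)
  also have "(\<Sum>t\<in>I. LINT p|\<mu>. ratio p * curv_diff p * f t p) = (LINT p|\<mu>. curv_diff p)"
  proof -
    have "(LINT p|\<mu>. curv_diff p) = (LINT p|\<mu>. (\<Sum>t\<in>I. ratio p * curv_diff p * f t p))"
      by (rule Bochner_Integration.integral_cong[OF refl B])
    also have "\<dots> = (\<Sum>t\<in>I. LINT p|\<mu>. ratio p * curv_diff p * f t p)"
      by (rule Bochner_Integration.integral_sum) (rule st(2))
    finally show ?thesis ..
  qed
  finally show "(LINT p|\<mu>. flow (\<lambda>p. 1 / ratio p) p / qz p) = 2 * (LINT p|\<mu>. curv_diff p)" .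
qed

section \<open>The derivative along Z as a quadratic form in Z\<close>

lemma flow_recip_ratio:
  assumes c: "c \<in> A" and u: "u \<in> chart_range c"
  shows "flow_chart c (\<lambda>p. 1 / ratio p) u = - flow_chart c ratio u / (local_rep c ratio u)\<^sup>2"
proof -
  have pos: "local_rep c ratio u > 0" using ratio_pos in_M[OF c u] by (simp add: local_rep_apply)
  have "D i c (\<lambda>p. 1 / ratio p) u = - inverse ((local_rep c ratio u)\<^sup>2) * D i c ratio u" for i
  proof -
    have "partial i (\<lambda>u. inverse (local_rep c ratio u)) u = - inverse ((local_rep c ratio u)\<^sup>2) * D i c ratio u"
      using pos C1_differentiable[OF C1_on_surfaceD[OF ratio_C1 c] u]
      by (intro partial_real_compose)
        (auto intro!: derivative_eq_intros simp: power2_eq_square)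
    moreover have "local_rep c (\<lambda>p. 1 / ratio p) = (\<lambda>u. inverse (local_rep c ratio u))"
      by (simp add: local_rep_def o_def inverse_eq_divide)
    ultimately show ?thesis by simp
  qed
  then show ?thesis
    using pos vol_nonzero[OF c u] local_qz_pos[OF c u] by (simp add: flow_chart_def field_simps)
qed

definition tangent :: "'a chart \<Rightarrow> real^2 \<Rightarrow> real^2" where
  "tangent c u = (\<chi> i. flux c i u / (vol c u * local_rep c qz u))"

text \<open>Replacing \<open>y\<close> by Z leaves \<open>flux\<close> unchanged, because the triple
  products also contain \<open>z\<close>. As Z is tangent, these are \<open>qz\<close> times the
  triple products with \<xi>, and Cramer's rule identifies the components of \<open>tangent\<close>
  as the coordinates of Z.\<close>

lemma tangent_eq:
  assumes c: "c \<in> A" and u: "u \<in> chart_range c"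
  shows "local_rep c y u - local_rep c ratio u *\<^sub>R local_rep c z u
    = tangent c u $ 1 *\<^sub>R D 1 c x u + tangent c u $ 2 *\<^sub>R D 2 c x u"
proof -
  let ?y = "local_rep c y u" and ?z = "local_rep c z u" and ?\<xi> = "local_rep c \<xi> u"
  let ?Z = "?y - local_rep c ratio u *\<^sub>R ?z" and ?a = "\<lambda>i. D i c x u"
  have qz: "local_rep c qz u > 0" by (rule local_qz_pos[OF c u])
  have \<xi>Z: "?\<xi> \<bullet> ?Z = 0"
    using qz by (simp add: inner_diff_right local_rep_apply ratio_def support_fun_def)
  have f1: "flux c 1 u = (cross3 ?Z (?a 2) \<bullet> ?\<xi>) * local_rep c qz u"
  proof -
    have "flux c 1 u = cross3 ?Z (?a 2) \<bullet> ?z"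
      by (simp add: flux_def Cross3.left_diff_distrib cross_mult_left inner_diff_left dot_cross_self)
    then show ?thesis
      unfolding local_rep_qz
      by (simp only: cross3_dot_eq[OF norm_\<xi>[OF c u] \<xi>Z \<xi>_Dx[OF c u], where v = ?z])
  qed
  have f2: "flux c 2 u = (cross3 (?a 1) ?Z \<bullet> ?\<xi>) * local_rep c qz u"
  proof -
    have "flux c 2 u = cross3 (?a 1) ?Z \<bullet> ?z"
      by (simp add: flux_def Cross3.right_diff_distrib cross_mult_right inner_diff_left dot_cross_self)
    then show ?thesis
      unfolding local_rep_qz
      by (simp only: cross3_dot_eq[OF norm_\<xi>[OF c u] \<xi>_Dx[OF c u] \<xi>Z, where v = ?z])
  qed
  have "vol c u *\<^sub>R ?Z = (cross3 ?Z (?a 2) \<bullet> ?\<xi>) *\<^sub>R ?a 1 + (cross3 (?a 1) ?Z \<bullet> ?\<xi>) *\<^sub>R ?a 2"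
    using cross3_Cramer[of "?a 1" "?a 2" ?\<xi> ?Z] \<xi>Z
      cross3_dot_eq[OF norm_\<xi>[OF c u] \<xi>_Dx[OF c u] \<xi>_Dx[OF c u], of 1 2 ?Z]
    by (simp add: vol_def)
  then have "?Z = (1 / vol c u) *\<^sub>R ((cross3 ?Z (?a 2) \<bullet> ?\<xi>) *\<^sub>R ?a 1 + (cross3 (?a 1) ?Z \<bullet> ?\<xi>) *\<^sub>R ?a 2)"
    using vol_nonzero[OF c u] by (simp add: eq_vector_fraction_iff)
  moreover have "tangent c u $ 1 = (cross3 ?Z (?a 2) \<bullet> ?\<xi>) / vol c u"
    "tangent c u $ 2 = (cross3 (?a 1) ?Z \<bullet> ?\<xi>) / vol c u"
    using qz by (simp_all add: tangent_def f1 f2)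
  ultimately show ?thesis by (simp add: scaleR_add_right)
qed

lemma D_ratio:
  assumes c: "c \<in> A" and u: "u \<in> chart_range c"
  shows "D i c ratio u * local_rep c qz u = - (\<Sum>j\<in>UNIV. tangent c u $ j * second_form c x \<xi> u $ j $ i)"
proof -
  let ?Z = "\<lambda>u. local_rep c y u - local_rep c ratio u *\<^sub>R local_rep c z u"
  note d = C1_differentiable[OF y_C1[OF c] u] C1_differentiable[OF z_C1[OF c] u]
    C1_differentiable[OF \<xi>_C1[OF c] u] C1_differentiable[OF C1_on_surfaceD[OF ratio_C1 c] u]
  note dz = C1_differentiable[OF C1_scaleR[OF C1_on_surfaceD[OF ratio_C1 c] z_C1[OF c]] u]
  have "partial i (\<lambda>u. local_rep c \<xi> u \<bullet> ?Z u) u = partial i (\<lambda>_. 0) u"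
  proof (rule partial_cong_open[OF open_chart_range[OF c] u])
    fix v assume "v \<in> chart_range c"
    from local_qz_pos[OF c this] show "local_rep c \<xi> v \<bullet> ?Z v = 0"
      by (simp add: inner_diff_right local_rep_apply ratio_def support_fun_def)
  qed
  then have "local_rep c \<xi> u \<bullet> (D i c y u - (local_rep c ratio u *\<^sub>R D i c z u + D i c ratio u *\<^sub>R local_rep c z u))
      + D i c \<xi> u \<bullet> ?Z u = 0"
    by (simp add: partial_inner partial_diff partial_scaleR d dz differentiable_diff partial_eq[OF has_derivative_const])
  \<comment> \<open>The derivatives of \<open>y\<close> and \<open>z\<close> are tangent, so only
    the derivatives of \<open>ratio\<close> and of \<xi> survive.\<close>
  then have "D i c ratio u * local_rep c qz u = D i c \<xi> u \<bullet> ?Z u"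
    by (simp add: inner_diff_right inner_add_right tangent_Dy[OF c u] tangent_Dz[OF c u] local_rep_qz)
  also have "\<dots> = - (\<Sum>j\<in>UNIV. tangent c u $ j * second_form c x \<xi> u $ j $ i)"
    unfolding tangent_eq[OF c u] by (simp add: second_form_eq[OF c u] sum_2 inner_add_right)
  finally show ?thesis .
qed

text \<open>Combines d(1/w) = -dw/w^2 with q_aff dw(Z) = -II(Z, Z). The two signs cancel, which is
  why the weight 1/w leads to a nonnegative integrand.\<close>

lemma flow_recip_ratio_eq:
  assumes c: "c \<in> A" and u: "u \<in> chart_range c"
  shows "flow_chart c (\<lambda>p. 1 / ratio p) u
    = tangent c u \<bullet> (second_form c x \<xi> u *v tangent c u) / (local_rep c qz u * (local_rep c ratio u)\<^sup>2)"
proof -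
  let ?Q = "local_rep c qz u" and ?t = "tangent c u" and ?h = "second_form c x \<xi> u"
  have Q: "?Q > 0" by (rule local_qz_pos[OF c u])
  have "flow_chart c ratio u * ?Q = ?t $ 1 * (D 1 c ratio u * ?Q) + ?t $ 2 * (D 2 c ratio u * ?Q)"
    by (simp add: flow_chart_def tangent_def add_divide_distrib algebra_simps)
  also have "\<dots> = - (?t \<bullet> (?h *v ?t))"
    unfolding D_ratio[OF c u] by (simp add: sum_2 inner_vec_def matrix_vector_mult_def algebra_simps)
  finally have "- flow_chart c ratio u = ?t \<bullet> (?h *v ?t) / ?Q"
    using Q by (simp add: field_simps)
  then show ?thesis
    unfolding flow_recip_ratio[OF c u] by simp
qed

lemma flow_recip_ratio_nonneg:
  assumes c: "c \<in> A" and u: "u \<in> chart_range c"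
  shows "0 \<le> flow_chart c (\<lambda>p. 1 / ratio p) u"
    and "flow_chart c (\<lambda>p. 1 / ratio p) u = 0 \<Longrightarrow> D i c ratio u = 0"
proof -
  have pos: "local_rep c qz u > 0" "local_rep c ratio u > 0"
    using local_qz_pos[OF c u] ratio_pos in_M[OF c u] by (simp_all add: local_rep_apply)
  have h: "v \<noteq> 0 \<Longrightarrow> 0 < v \<bullet> (second_form c x \<xi> u *v v)" for v
    using II_pos c u unfolding positive_definite_II_def by blast
  then have "0 \<le> v \<bullet> (second_form c x \<xi> u *v v)" for v
    by (cases "v = 0") (auto intro: less_imp_le)
  then show "0 \<le> flow_chart c (\<lambda>p. 1 / ratio p) u"
    unfolding flow_recip_ratio_eq[OF c u] using pos by simp
  assume "flow_chart c (\<lambda>p. 1 / ratio p) u = 0"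
  then have "tangent c u = 0"
    using pos h[of "tangent c u"] unfolding flow_recip_ratio_eq[OF c u] by auto
  then show "D i c ratio u = 0"
    using D_ratio[OF c u, of i] pos by simp
qed

text \<open>Vanishing partial derivatives give constancy on a ball inside a chart range. Such balls
  make \<open>ratio\<close> locally constant on \<open>M\<close>, and connectedness does the
  rest.\<close>

lemma ratio_constant:
  assumes conn: "connected M" and D0: "\<And>c u i. c \<in> A \<Longrightarrow> u \<in> chart_range c \<Longrightarrow> D i c ratio u = 0"
    and p: "p \<in> M" "p' \<in> M"
  shows "ratio p = ratio p'"
proof (rule connected_local_const[OF conn p], rule ballI)
  fix a assume "a \<in> M"
  then obtain c where c: "c \<in> A" "a \<in> fst c" using charts_cover by blast
  obtain e where e: "e > 0" "ball (snd c a) e \<subseteq> chart_range c"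
    using open_chart_range[OF c(1)] c(2) open_contains_ball by blast
  have "\<exists>k. \<forall>u\<in>ball (snd c a) e. local_rep c ratio u = k"
  proof (rule has_derivative_zero_constant[OF convex_ball])
    fix u assume "u \<in> ball (snd c a) e"
    then have u: "u \<in> chart_range c" using e by blast
    have "(local_rep c ratio has_derivative (\<lambda>h. 0)) (at u)"
      using C1_has_derivative[OF C1_on_surfaceD[OF ratio_C1 c(1)] u]
      by (simp only: D0[OF c(1) u] scaleR_zero_right sum.neutral_const)
    then show "(local_rep c ratio has_derivative (\<lambda>h. 0)) (at u within ball (snd c a) e)"
      by (rule has_derivative_at_withinI)
  qed
  then obtain k where k: "\<And>u. u \<in> ball (snd c a) e \<Longrightarrow> local_rep c ratio u = k" by blast
  have const: "ratio b = k" if "b \<in> fst c \<inter> snd c -` ball (snd c a) e" for b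
    using k[of "snd c b"] that c(1) by simp
  obtain T where T: "open T" "fst c \<inter> snd c -` ball (snd c a) e = M \<inter> T"
    using openin_chart_preimage[OF c(1) open_ball] unfolding openin_open by blast
  have "a \<in> T" using T(2) c(2) e(1) \<open>a \<in> M\<close> by auto
  then have "\<forall>\<^sub>F b in at a within M. b \<in> M \<inter> T"
    using T(1) by (auto simp: eventually_at_topological)
  then show "\<forall>\<^sub>F b in at a within M. ratio a = ratio b"
  proof (rule eventually_mono)
    fix b assume "b \<in> M \<inter> T"
    then show "ratio a = ratio b"
      using const[of a] const[of b] T(2) \<open>a \<in> T\<close> \<open>a \<in> M\<close> by simp
  qed
qed

theorem integral_curv_diff_nonneg:
  assumes conn: "connected M" "M \<noteq> {}"
  shows "0 \<le> (LINT p|\<mu>. curv_diff p)"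
    and "(LINT p|\<mu>. curv_diff p) = 0 \<longleftrightarrow> constantly_proportional M \<xi> y z"
proof -
  let ?Q = "\<lambda>p. flow (\<lambda>p. 1 / ratio p) p / qz p"
  have nonneg: "0 \<le> ?Q p" if p: "p \<in> M" for p
  proof -
    note c = chart_at[OF p]
    have "0 \<le> flow (\<lambda>p. 1 / ratio p) p"
      unfolding flow_eq[OF recip_ratio_C1 c] by (rule flow_recip_ratio_nonneg(1)[OF c(1)]) (use c in blast)
    then show ?thesis using z_pos[OF p] by simp
  qed
  have sp: "space \<mu> = M"
    using sets_eq_imp_space_eq[OF sets_density_measure[OF has_density_area_II]] by (simp add: space_restrict_space)
  have "0 \<le> (LINT p|\<mu>. ?Q p)"
    using nonneg sp by (intro Bochner_Integration.integral_nonneg) auto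
  then show "0 \<le> (LINT p|\<mu>. curv_diff p)"
    using integral_curv_diff(3) by simp
  show "(LINT p|\<mu>. curv_diff p) = 0 \<longleftrightarrow> constantly_proportional M \<xi> y z"
  proof
    assume "(LINT p|\<mu>. curv_diff p) = 0"
    then have 0: "(LINT p|\<mu>. ?Q p) = 0" using integral_curv_diff(3) by simp
    have cont: "continuous_on (chart_range c) (local_rep c ?Q)" if c: "c \<in> A" for c
      using flow_cont[OF recip_ratio_C1 c] C1_continuous[OF C1_on_surfaceD[OF qz_C1 c]] local_qz_pos[OF c]
      unfolding local_rep_def o_def by (intro continuous_on_divide) (auto simp: less_le)
    have Q0: "?Q p = 0" if "p \<in> M" for p
      by (rule integral_nonneg_eq_0_imp[OF has_density_area_II cont nonneg integral_curv_diff(1) 0 that])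
    have D0: "D i c ratio u = 0" if c: "c \<in> A" and u: "u \<in> chart_range c" for c u i
    proof (rule flow_recip_ratio_nonneg(2)[OF c u])
      show "flow_chart c (\<lambda>p. 1 / ratio p) u = 0"
        using Q0[OF in_M[OF c u]] local_qz_pos[OF c u] local_rep_flow[OF recip_ratio_C1 c u]
        by (simp add: local_rep_apply)
    qed
    \<comment> \<open>The constant of proportionality is the value of \<open>ratio\<close> at any
      one point; being positive it is nonzero.\<close>
    obtain p0 where p0: "p0 \<in> M" using conn(2) by blast
    have "q p = ratio p0 * qz p" if "p \<in> M" for p
    proof -
      have "q p = ratio p * qz p" using z_pos[OF that] by (simp add: ratio_def)
      then show ?thesis using ratio_constant[OF conn(1) D0 that p0] by simp
    qed
    then show "constantly_proportional M \<xi> y z"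
      unfolding constantly_proportional_def using ratio_pos[OF p0] by (intro exI[of _ "ratio p0"]) auto
  next
    assume "constantly_proportional M \<xi> y z"
    then obtain k where k: "\<And>p. p \<in> M \<Longrightarrow> q p = k * qz p"
      unfolding constantly_proportional_def by blast
    \<comment> \<open>Proportionality makes the quotient constant, so the differential of its
      reciprocal is zero and with it the integrand in the Stokes identity.\<close>
    have ratio_k: "ratio p = k" if "p \<in> M" for p
      using k[OF that] z_pos[OF that] by (simp add: ratio_def)
    have "?Q p = 0" if p: "p \<in> M" for p
    proof -
      note c = chart_at[OF p]
      let ?c = "chart_at A p"
      have u: "snd ?c p \<in> chart_range ?c" using c by blast
      have "D i ?c (\<lambda>p. 1 / ratio p) (snd ?c p) = partial i (\<lambda>_. 1 / k) (snd ?c p)" for i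
        by (rule partial_cong_open[OF open_chart_range[OF c(1)] u])
          (use ratio_k in_M[OF c(1)] in \<open>simp add: local_rep_apply\<close>)
      then show ?thesis
        by (simp add: flow_def flow_chart_def partial_eq[OF has_derivative_const])
    qed
    then have "(LINT p|\<mu>. ?Q p) = (LINT p|\<mu>. 0)"
      using sp by (intro Bochner_Integration.integral_cong) auto
    then show "(LINT p|\<mu>. curv_diff p) = 0"
      using integral_curv_diff(3) by simp
  qed
qed

end

lemma Ck_atlas_mono: "Ck_atlas r M A \<Longrightarrow> k \<le> r \<Longrightarrow> Ck_atlas k M A"
  unfolding Ck_atlas_def by (blast intro: Ck_on_mono)

lemma relative_normalization_mono:
  "relative_normalization s A x y \<Longrightarrow> k \<le> s \<Longrightarrow> relative_normalization k A x y"
  unfolding relative_normalization_def Ck_map_def by (blast intro: Ck_on_mono)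

theorem proposition4p3:
  fixes M :: "'a::t2_space set" and A :: "'a chart set"
    and x \<xi> y y_aff :: "'a \<Rightarrow> real^3"
    and r s s' :: nat
  assumes "3 \<le> r"
    and "ovaloid r M A x \<xi>"
    and "1 \<le> s" and "s < r"
    and "relative_normalization s A x y"
    and "\<forall>p\<in>M. support_fun \<xi> y p > 0"
    and "1 \<le> s'" and "s' < r"
    and "equiaffine_normalization s' M A x \<xi> y_aff"
  shows
    "0 \<le> (LINT p|area_II M A x \<xi>.
            mean_relative_curvature A x y p / support_fun \<xi> y p
            - mean_relative_curvature A x y_aff p / support_fun \<xi> y_aff p) \<and>
     ((LINT p|area_II M A x \<xi>.
            mean_relative_curvature A x y p / support_fun \<xi> y p
            - mean_relative_curvature A x y_aff p / support_fun \<xi> y_aff p) = 0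
      \<longleftrightarrow> constantly_proportional M \<xi> y y_aff)"
proof -
  have surf: "Ck_atlas r M A" "compact M" "connected M" "M \<noteq> {}" "Ck_map r A x"
    using assms(2) by (auto simp: ovaloid_def closed_oriented_surface_def)
  \<comment> \<open>\<open>3 \<le> r\<close> supplies the C^1 atlas and the C^2 immersion of the
    locale; both normalizations are lowered to class C^1.\<close>
  interpret relative_pair M A x \<xi> y y_aff
  proof
    show "Ck_atlas 1 M A" by (rule Ck_atlas_mono[OF surf(1)]) (use assms(1) in simp)
    show "Ck_on 2 (local_rep c x) (chart_range c)" if "c \<in> A" for c
    proof (rule Ck_on_mono)
      show "Ck_on r (local_rep c x) (chart_range c)" using surf(5) that by (simp add: Ck_map_def)
      show "2 \<le> r" using assms(1) by simp
    qed
    show "relative_normalization 1 A x y"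
      by (rule relative_normalization_mono[OF assms(5,3)])
    show "relative_normalization 1 A x y_aff"
      using assms(9) unfolding equiaffine_normalization_def
      by (blast intro: relative_normalization_mono[OF _ assms(7)])
    show "support_fun \<xi> y_aff p = \<bar>gauss_curvature A x \<xi> p\<bar> powr (1 / 4)" if "p \<in> M" for p
      using assms(9) that unfolding equiaffine_normalization_def by blast
  qed (use assms(2,6) surf(2) in \<open>simp_all add: ovaloid_def\<close>)
  show ?thesis
    using integral_curv_diff_nonneg[OF surf(3,4)] unfolding curv_diff_def[abs_def] by blast
qed

end
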